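(* For each integer $r \geq 2$, let $d_{r,r}^*$ be the smallest nonnegative integer such that whenever $X$ is an edge-subgraph of $K_{r,r}$ with $\delta(X) \geq d_{r,r}^*$, the friends-and-strangers graph $\mathsf{FS}(X,K_{r,r})$ has exactly two connected components. Then $$d_{r,r}^* = \begin{cases} \lfloor r/2 \rfloor + 1 & \text{if } r \neq 3, \\ 3 & \text{if } r = 3. \end{cases}$$
   Context: All graphs are simple. $K_{r,r}$ is the complete bipartite graph whose two partite sets both have size $r$. An edge-subgraph of a graph $G$ is a graph with the same vertex set as $G$ whose edge set is a subset of $E(G)$. $\delta(G)$ denotes the minimum degree of $G$. For simple graphs $X$ and $Y$ on $n$ vertices each, the friends-and-strangers graph $\mathsf{FS}(X,Y)$ is the graph whose vertices are all bijections $V(X) \to V(Y)$, in which two bijections $\sigma, \tau$ are adjacent if and only if there is an edge $\{a,b\} \in E(X)$ such that $\{\sigma(a),\sigma(b)\} \in E(Y)$, $\sigma(a)=\tau(b)$, $\sigma(b)=\tau(a)$, and $\sigma(c)=\tau(c)$ for all $c \in V(X)\setminus\{a,b\}$. *)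

theory Defs
  imports "Graph_Theory.Graph_Theory" "HOL-Library.FuncSet"
begin

text \<open>
  As in the AFP library of digraphs, a simple graph is a \<^locale>\<open>pair_graph\<close>: a finite loop-free symmetric
  digraph whose arcs are ordered pairs, each edge \<open>{a, b}\<close> being represented by the two arcs
  \<open>(a, b)\<close> and \<open>(b, a)\<close>.
\<close>

definition K_rr :: "nat \<Rightarrow> (nat + nat) pair_pre_digraph" where
  "K_rr r =
    \<lparr> pverts = Inl ` {..<r} \<union> Inr ` {..<r},
      parcs = (Inl ` {..<r}) \<times> (Inr ` {..<r}) \<union> (Inr ` {..<r}) \<times> (Inl ` {..<r}) \<rparr>"

lemma complete_bipartite_K_rr: "complete_bipartite_digraph r r (with_proj (K_rr r))"
  unfolding complete_bipartite_digraph_pair_def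
  by (intro conjI exI[of _ "Inl ` {..<r}"] exI[of _ "Inr ` {..<r}"])
     (auto simp: K_rr_def card_image)

definition edge_subgraph :: "'a pair_pre_digraph \<Rightarrow> 'a pair_pre_digraph \<Rightarrow> bool" where
  "edge_subgraph X G \<longleftrightarrow> pair_graph X \<and> spanning (with_proj X) (with_proj G)"

text \<open>In a symmetric digraph the out-degree of a vertex is its number of neighbours.\<close>

definition min_degree :: "'a pair_pre_digraph \<Rightarrow> nat" where
  "min_degree G = Min (out_degree (with_proj G) ` pverts G)"

text \<open>
  Bijections are taken extensional on the vertex set, so that each one is represented by exactly
  one HOL function.
\<close>

definition vertex_bijections ::
    "'a pair_pre_digraph \<Rightarrow> 'b pair_pre_digraph \<Rightarrow> ('a \<Rightarrow> 'b) set" where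
  "vertex_bijections X Y =
    {\<sigma> \<in> extensional (pverts X). bij_betw \<sigma> (pverts X) (pverts Y)}"

definition FS ::
    "'a pair_pre_digraph \<Rightarrow> 'b pair_pre_digraph \<Rightarrow> ('a \<Rightarrow> 'b) pair_pre_digraph" where
  "FS X Y =
    \<lparr> pverts = vertex_bijections X Y,
      parcs = {(\<sigma>, \<tau>). \<sigma> \<in> vertex_bijections X Y \<and> \<tau> \<in> vertex_bijections X Y \<and>
        (\<exists>a b. (a, b) \<in> parcs X \<and> (\<sigma> a, \<sigma> b) \<in> parcs Y \<and>
          \<sigma> a = \<tau> b \<and> \<sigma> b = \<tau> a \<and> (\<forall>c \<in> pverts X - {a, b}. \<sigma> c = \<tau> c))} \<rparr>"

lemma pair_graph_FS:
  assumes X: "pair_graph X" and Y: "pair_graph Y"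
  shows "pair_graph (FS X Y)"
proof -
  interpret X: pair_graph X by (rule X)
  interpret Y: pair_graph Y by (rule Y)
  have "vertex_bijections X Y \<subseteq> pverts X \<rightarrow>\<^sub>E pverts Y"
    by (auto simp: vertex_bijections_def PiE_def bij_betw_def)
  then have fin: "finite (vertex_bijections X Y)"
    by (rule finite_subset) (simp add: finite_PiE)
  have sub: "parcs (FS X Y) \<subseteq> vertex_bijections X Y \<times> vertex_bijections X Y"
    by (auto simp: FS_def)
  have verts: "pverts (FS X Y) = vertex_bijections X Y"
    by (simp add: FS_def)
  show ?thesis
  proof
    show "finite (parcs (FS X Y))"
      using sub fin by (meson finite_SigmaI finite_subset)
    show "fst e \<noteq> snd e" if "e \<in> parcs (FS X Y)" for e
    proof
      assume "fst e = snd e"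
      with that obtain \<sigma> a b where "(\<sigma> a, \<sigma> b) \<in> parcs Y" "\<sigma> a = \<sigma> b"
        by (auto simp: FS_def)
      then show False using Y.pair_no_loops by force
    qed
    have symY: "(v, u) \<in> parcs Y" if "(u, v) \<in> parcs Y" for u v
      using arcs_ends_symmetric[OF Y.pair_sym_arcs] that by simp
    have "(\<tau>, \<sigma>) \<in> parcs (FS X Y)" if st: "(\<sigma>, \<tau>) \<in> parcs (FS X Y)" for \<sigma> \<tau>
    proof -
      obtain a b where ab: "(a, b) \<in> parcs X" "(\<sigma> a, \<sigma> b) \<in> parcs Y" "\<sigma> a = \<tau> b" "\<sigma> b = \<tau> a"
          "\<forall>c \<in> pverts X - {a, b}. \<sigma> c = \<tau> c"
        using st by (auto simp: FS_def)
      have "(\<tau> a, \<tau> b) \<in> parcs Y" using symY ab by metis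
      moreover have "\<forall>c \<in> pverts X - {a, b}. \<tau> c = \<sigma> c" using ab by simp
      ultimately have "\<exists>a b. (a, b) \<in> parcs X \<and> (\<tau> a, \<tau> b) \<in> parcs Y \<and>
          \<tau> a = \<sigma> b \<and> \<tau> b = \<sigma> a \<and> (\<forall>c \<in> pverts X - {a, b}. \<tau> c = \<sigma> c)"
        using ab by metis
      then show ?thesis using st by (simp add: FS_def)
    qed
    then show "symmetric (with_proj (FS X Y))"
      by (auto simp: symmetric_def intro: symI)
  qed (use sub fin verts in auto)
qed

text \<open>
  By the previous lemma \<open>FS X Y\<close> is symmetric whenever \<open>X\<close> and \<open>Y\<close> are simple graphs, so its strongly
  connected components are its connected components.
\<close>

definition num_components :: "'a pair_pre_digraph \<Rightarrow> nat" where
  "num_components G = card (pre_digraph.sccs (with_proj G))"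

definition forces_two_components :: "nat \<Rightarrow> nat \<Rightarrow> bool" where
  "forces_two_components r d \<longleftrightarrow>
    (\<forall>X. edge_subgraph X (K_rr r) \<and> min_degree X \<ge> d \<longrightarrow> num_components (FS X (K_rr r)) = 2)"

definition d_star :: "nat \<Rightarrow> nat" where
  "d_star r = (LEAST d. forces_two_components r d)"

text \<open>The minimum is over a nonempty set: degrees in \<open>K_rr r\<close> are at most \<open>r\<close>.\<close>

lemma ex_forces_two_components:
  assumes "r \<ge> 1"
  shows "\<exists>d. forces_two_components r d"
proof
  show "forces_two_components r (Suc r)"
    unfolding forces_two_components_def
  proof (intro allI impI, elim conjE)
    fix X assume X: "edge_subgraph X (K_rr r)" and deg: "Suc r \<le> min_degree X"
    have V: "pverts X = pverts (K_rr r)" and E: "parcs X \<subseteq> parcs (K_rr r)"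
      using X by (auto simp: edge_subgraph_def spanning_def subgraph_def)
    have v: "Inl 0 \<in> pverts X" and fin: "finite (pverts X)"
      using assms by (auto simp: V K_rr_def)
    have "out_arcs (with_proj X) (Inl 0) \<subseteq> {Inl 0} \<times> Inr ` {..<r}"
      using E by (auto simp: out_arcs_def K_rr_def)
    then have "card (out_arcs (with_proj X) (Inl 0)) \<le> card ({Inl 0 :: nat + nat} \<times> (Inr ` {..<r} :: (nat + nat) set))"
      by (intro card_mono) auto
    then have "out_degree (with_proj X) (Inl 0) \<le> r"
      by (simp add: out_degree_def card_image card_cartesian_product)
    moreover have "min_degree X \<le> out_degree (with_proj X) (Inl 0)"
      unfolding min_degree_def using v fin by (intro Min_le) auto
    ultimately show "num_components (FS X (K_rr r)) = 2"
      using deg by simp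
  qed
qed

end

theory Submission
  imports Defs "HOL-Combinatorics.Permutations"
begin

text \<open>
  Think of a bijection as persons of two colours (the sides of \<open>K\<^bsub>r,r\<^esub>\<close>) standing on the vertices
  of \<open>X\<close>; a move swaps two differently coloured persons along an edge of \<open>X\<close>. The sign of the
  bijection times \<open>-1\<close> to the number of left persons on left positions is invariant, so there are
  at least two components. Call a set \<open>W\<close> of positions full if, with at least two persons of each
  colour in \<open>W\<close>, any two arrangements of \<open>W\<close> of equal parity are connected by moves inside \<open>W\<close>. A
  4-cycle is full: rotating all its persons by two places swaps both pairs of equally coloured
  ones. A full set stays full when a neighbour \<open>w\<close> is added that has two neighbours in \<open>W\<close>, or whose
  neighbour in \<open>W\<close> has two neighbours in \<open>W\<close>, because any person can then be brought to \<open>w\<close> without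
  having to care about the others. If the degrees are at least \<open>d > r / 2\<close>, any two positions on the
  same side have a common neighbour, whence a maximal full set containing a 4-cycle contains every
  position; a 4-cycle exists by counting as soon as \<open>d (d - 1) \<ge> r\<close>.

  For the lower bounds, take two disjoint complete bipartite graphs with sides as equal as possible,
  where the set of persons in one of them is invariant, and for \<open>r = 3\<close> the hexagon, where the
  cyclic order of the persons of each colour is invariant.
\<close>

section \<open>Swaps of coloured persons on a bipartite graph\<close>

text \<open>\<open>s\<close> is the side of a position and \<open>c\<close> the colour of a person. Persons and positions share the
  type \<open>'a\<close>, so that a bijection has a sign.\<close>

locale bipartite_swaps =
  fixes V :: "'a set" and E :: "'a \<Rightarrow> 'a \<Rightarrow> bool" and s c :: "'a \<Rightarrow> bool"
  assumes fin: "finite V"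
    and sym: "E u v \<Longrightarrow> E v u"
    and mem: "E u v \<Longrightarrow> u \<in> V"
    and side: "E u v \<Longrightarrow> s u \<noteq> s v"
begin

lemma mem2: "E u v \<Longrightarrow> v \<in> V"
  using sym mem by blast

lemma irrefl: "\<not> E u u"
  using side by blast

definition step :: "'a set \<Rightarrow> ('a \<Rightarrow> 'a) \<Rightarrow> ('a \<Rightarrow> 'a) \<Rightarrow> bool" where
  "step W \<sigma> \<tau> \<longleftrightarrow> (\<exists>u\<in>W. \<exists>v\<in>W. E u v \<and> c (\<sigma> u) \<noteq> c (\<sigma> v) \<and> \<tau> = \<sigma> \<circ> transpose u v)"

abbreviation reach :: "'a set \<Rightarrow> ('a \<Rightarrow> 'a) \<Rightarrow> ('a \<Rightarrow> 'a) \<Rightarrow> bool" where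
  "reach W \<equiv> (step W)\<^sup>*\<^sup>*"

definition parity :: "('a \<Rightarrow> 'a) \<Rightarrow> bool" where
  "parity \<sigma> \<longleftrightarrow> (evenperm \<sigma> \<longleftrightarrow> even (card {v \<in> V. s v \<and> c (\<sigma> v)}))"

definition rearrangement :: "'a set \<Rightarrow> ('a \<Rightarrow> 'a) \<Rightarrow> ('a \<Rightarrow> 'a) \<Rightarrow> bool" where
  "rearrangement W \<sigma> \<tau> \<longleftrightarrow> \<sigma> permutes V \<and> \<tau> permutes V \<and> (\<forall>v. v \<notin> W \<longrightarrow> \<sigma> v = \<tau> v)"

definition num :: "'a set \<Rightarrow> bool \<Rightarrow> ('a \<Rightarrow> 'a) \<Rightarrow> nat" where
  "num W k \<sigma> = card {v \<in> W. c (\<sigma> v) = k}"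

definition connected_in :: "'a set \<Rightarrow> 'a \<Rightarrow> 'a \<Rightarrow> bool" where
  "connected_in W = (\<lambda>u v. u \<in> W \<and> v \<in> W \<and> E u v)\<^sup>*\<^sup>*"

text \<open>Since \<open>4 \<le> card W\<close>, some colour occurs three times after a position has been added: a person of
  that colour can stand on the new position while \<open>W\<close> keeps two persons of each colour.\<close>

definition full :: "'a set \<Rightarrow> bool" where
  "full W \<longleftrightarrow> W \<subseteq> V \<and> 4 \<le> card W \<and> (\<forall>u\<in>W. \<forall>v\<in>W. connected_in W u v) \<and>
    (\<forall>\<sigma> \<tau>. rearrangement W \<sigma> \<tau> \<longrightarrow> (\<forall>k. 2 \<le> num W k \<sigma>) \<longrightarrow> parity \<sigma> = parity \<tau> \<longrightarrow> reach W \<sigma> \<tau>)"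

section \<open>The parity invariant\<close>

lemma permutation_of_permutes: "\<sigma> permutes V \<Longrightarrow> permutation \<sigma>"
  using fin permutation_permutes by blast

lemma evenperm_transpose:
  assumes "\<sigma> permutes V" "u \<noteq> v"
  shows "evenperm (\<sigma> \<circ> transpose u v) \<longleftrightarrow> \<not> evenperm \<sigma>"
  using assms by (simp add: evenperm_comp permutation_of_permutes permutation_swap_id evenperm_swap)

text \<open>The colour pattern is untouched, so only the sign changes. Such an exchange is not a
  move; it serves to correct the parity of a freely chosen arrangement.\<close>

lemma parity_transpose_same_colour:
  assumes "\<sigma> permutes V" "u \<noteq> v" "c (\<sigma> u) = c (\<sigma> v)"
  shows "parity (\<sigma> \<circ> transpose u v) \<longleftrightarrow> \<not> parity \<sigma>"
proof -
  have "c ((\<sigma> \<circ> transpose u v) x) = c (\<sigma> x)" for x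
    using assms by (auto simp: transpose_def)
  then show ?thesis
    unfolding parity_def using evenperm_transpose[OF assms(1,2)] by auto
qed

text \<open>The ends of an edge lie on different sides, so exchanging two colours across it changes
  the counted number by exactly one, and the sign flips as well.\<close>

lemma parity_transpose_edge:
  assumes "\<sigma> permutes V" "E u v" "c (\<sigma> u) \<noteq> c (\<sigma> v)"
  shows "parity (\<sigma> \<circ> transpose u v) \<longleftrightarrow> parity \<sigma>"
proof -
  have *: "parity (\<sigma> \<circ> transpose u v) \<longleftrightarrow> parity \<sigma>"
    if uv: "E u v" "c (\<sigma> u)  \<noteq> c (\<sigma> v)" "s u" for u v
  proof -
    have n: "u \<noteq> v" "\<not> s v" "u \<in> V" using uv irrefl side mem by auto
    \<comment> \<open>Only \<open>u\<close> of the two ends can be counted, since \<open>v\<close>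
      lies on the other side; the swap decides whether \<open>u\<close> joins
      \<open>A\<close>.\<close>
    define A where "A = {x \<in> V - {u}. s x \<and> c (\<sigma> x)}"
    have A: "finite A" "u \<notin> A" using fin by (auto simp: A_def)
    have "{x \<in> V. s x \<and> c (\<sigma> x)} = (if c (\<sigma> u) then insert u A else A)"
      using n uv by (auto simp: A_def)
    moreover have "{x \<in> V. s x \<and> c ((\<sigma> \<circ> transpose u v) x)} = (if c (\<sigma> u) then A else insert u A)"
      using n uv by (auto simp: A_def transpose_def split: if_splits)
    ultimately show ?thesis
      unfolding parity_def using evenperm_transpose[OF assms(1) n(1)] A by auto
  qed
  show ?thesis
  proof (cases "s u")
    case True
    then show ?thesis using * assms by blast
  next
    case False
    then have "s v" using side assms by blast
    then show ?thesis using *[of v u] assms sym by (metis transpose_commute)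
  qed
qed

section \<open>Rearrangements and colour counts\<close>

lemma rearrangement_refl: "\<sigma> permutes V \<Longrightarrow> rearrangement W \<sigma> \<sigma>"
  by (simp add: rearrangement_def)

lemma rearrangement_sym: "rearrangement W \<sigma> \<tau> \<Longrightarrow> rearrangement W \<tau> \<sigma>"
  by (simp add: rearrangement_def)

lemma rearrangement_trans:
  "rearrangement W \<sigma> \<tau> \<Longrightarrow> rearrangement W \<tau> \<upsilon> \<Longrightarrow> rearrangement W \<sigma> \<upsilon>"
  by (simp add: rearrangement_def)

lemma rearrangement_transpose:
  assumes "\<sigma> permutes V" "W \<subseteq> V" "u \<in> W" "v \<in> W"
  shows "rearrangement W \<sigma> (\<sigma> \<circ> transpose u v)"
  using assms unfolding rearrangement_def
  by (auto intro!: permutes_compose permutes_swap_id simp: transpose_def)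

lemma rearrangement_image:
  assumes "rearrangement W \<sigma> \<tau>"
  shows "\<sigma> ` W = \<tau> ` W"
proof -
  have b: "bij \<sigma>" "bij \<tau>" using assms permutes_bij unfolding rearrangement_def by blast+
  have "\<sigma> ` (- W) = \<tau> ` (- W)" using assms unfolding rearrangement_def by auto
  then show ?thesis using b by (metis bij_image_Compl_eq double_compl)
qed

text \<open>The number depends only on the set of persons standing in \<open>W\<close>, which both
  arrangements share.\<close>

lemma num_rearrangement:
  assumes "rearrangement W \<sigma> \<tau>"
  shows "num W k \<sigma> = num W k \<tau>"
proof -
  have *: "num W k \<upsilon> = card {p \<in> \<upsilon> ` W. c p = k}" if "\<upsilon> permutes V" for \<upsilon>
  proof -
    have "{p \<in> \<upsilon> ` W. c p = k} = \<upsilon> ` {v \<in> W. c (\<upsilon> v) = k}" by auto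
    moreover have "inj \<upsilon>" using that permutes_inj by blast
    ultimately show ?thesis by (simp add: num_def card_image inj_on_subset)
  qed
  show ?thesis
    using assms rearrangement_image[OF assms] * by (simp add: rearrangement_def)
qed

lemma num_insert:
  assumes "finite W" "w \<notin> W"
  shows "num (insert w W) k \<sigma> = num W k \<sigma> + (if c (\<sigma> w) = k then 1 else 0)"
proof -
  have "{v \<in> insert w W. c (\<sigma> v) = k} =
      (if c (\<sigma> w) = k then insert w {v \<in> W. c (\<sigma> v) = k} else {v \<in> W. c (\<sigma> v) = k})"
    by auto
  then show ?thesis using assms by (simp add: num_def)
qed

lemma num_pos_ex:
  assumes "0 < num W k \<sigma>"
  shows "\<exists>v\<in>W. c (\<sigma> v) = k"
proof -
  have "{v \<in> W. c (\<sigma> v) = k} \<noteq> {}" using assms unfolding num_def by (metis card.empty less_irrefl)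
  then show ?thesis by blast
qed

lemma num_two_ex:
  assumes "2 \<le> num W k \<sigma>"
  shows "\<exists>u\<in>W. \<exists>v\<in>W. u \<noteq> v \<and> c (\<sigma> u) = k \<and> c (\<sigma> v) = k"
proof -
  obtain B where "B \<subseteq> {v \<in> W. c (\<sigma> v) = k}" "card B = 2"
    using assms obtain_subset_with_card_n unfolding num_def by metis
  then obtain u v where "B = {u, v}" "u \<noteq> v" by (auto simp: card_2_iff)
  then have "u \<in> W" "v \<in> W" "u \<noteq> v" "c (\<sigma> u) = k" "c (\<sigma> v) = k"
    using \<open>B \<subseteq> _\<close> by auto
  then show ?thesis by (intro bexI[of _ u] bexI[of _ v] conjI)
qed

lemma num_both:
  assumes "finite W"
  shows "num W True \<sigma> + num W False \<sigma> = card W"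
proof -
  have "W = {v \<in> W. c (\<sigma> v) = True} \<union> {v \<in> W. c (\<sigma> v) = False}" by auto
  then have "card W = card ({v \<in> W. c (\<sigma> v) = True} \<union> {v \<in> W. c (\<sigma> v) = False})" by simp
  also have "\<dots> = num W True \<sigma> + num W False \<sigma>"
    unfolding num_def using assms by (intro card_Un_disjoint) auto
  finally show ?thesis by simp
qed

section \<open>Moves, their invariants and the transport of colours\<close>

lemma stepI:
  "E u v \<Longrightarrow> u \<in> W \<Longrightarrow> v \<in> W \<Longrightarrow> c (\<sigma> u) \<noteq> c (\<sigma> v) \<Longrightarrow> step W \<sigma> (\<sigma> \<circ> transpose u v)"
  by (auto simp: step_def)

lemma step_sym: "step W \<sigma> \<tau> \<Longrightarrow> step W \<tau> \<sigma>"
proof -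
  assume "step W \<sigma> \<tau>"
  then obtain u v where uv: "u \<in> W" "v \<in> W" "E u v" "c (\<sigma> u) \<noteq> c (\<sigma> v)" "\<tau> = \<sigma> \<circ> transpose u v"
    by (auto simp: step_def)
  have "\<sigma> = \<tau> \<circ> transpose u v" by (simp add: uv comp_assoc)
  moreover have "step W \<tau> (\<tau> \<circ> transpose u v)" using uv by (intro stepI) auto
  ultimately show ?thesis by simp
qed

lemma reach_sym: "reach W \<sigma> \<tau> \<Longrightarrow> reach W \<tau> \<sigma>"
  by (induction rule: rtranclp_induct) (auto intro: step_sym converse_rtranclp_into_rtranclp)

lemma reach_mono:
  assumes "reach W \<sigma> \<tau>" "W \<subseteq> W'"
  shows "reach W' \<sigma> \<tau>"
proof -
  have "step W \<le> step W'" using assms(2) by (fastforce simp: step_def)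
  then show ?thesis using assms(1) rtranclp_mono by blast
qed

lemma reach_invariants:
  assumes "reach W \<sigma> \<tau>" "\<sigma> permutes V" "W \<subseteq> V"
  shows "rearrangement W \<sigma> \<tau>" and "parity \<tau> = parity \<sigma>"
proof -
  have "rearrangement W \<sigma> \<tau> \<and> parity \<tau> = parity \<sigma>"
    using assms(1)
  proof (induction rule: rtranclp_induct)
    case base
    then show ?case using assms by (simp add: rearrangement_refl)
  next
    case (step \<tau> \<upsilon>)
    then have p: "\<tau> permutes V" by (simp add: rearrangement_def)
    obtain u v where uv: "u \<in> W" "v \<in> W" "E u v" "c (\<tau> u) \<noteq> c (\<tau> v)" "\<upsilon> = \<tau> \<circ> transpose u v"
      using step(2) by (auto simp: step_def)
    show ?case
      unfolding uv(5)
      using step(3) rearrangement_transpose[OF p assms(3) uv(1,2)] parity_transpose_edge[OF p uv(3,4)]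
      by (blast intro: rearrangement_trans)
  qed
  then show "rearrangement W \<sigma> \<tau>" "parity \<tau> = parity \<sigma>" by auto
qed

lemma reach_three:
  assumes "step W \<sigma> \<sigma>1" "step W \<sigma>1 \<sigma>2" "step W \<sigma>2 \<sigma>3"
  shows "reach W \<sigma> \<sigma>3"
proof -
  have "reach W \<sigma> \<sigma>2"
    using r_into_rtranclp[of "step W", OF assms(1)] assms(2)
    by (rule rtranclp.rtrancl_into_rtrancl[of "step W"])
  then show ?thesis using assms(3) by (rule rtranclp.rtrancl_into_rtrancl[of "step W"])
qed

lemma reach_four:
  assumes "step W \<sigma> \<sigma>1" "step W \<sigma>1 \<sigma>2" "step W \<sigma>2 \<sigma>3" "step W \<sigma>3 \<sigma>4"
  shows "reach W \<sigma> \<sigma>4"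
  using reach_three[OF assms(1-3)] assms(4)
  by (rule rtranclp.rtrancl_into_rtrancl[of "step W"])

text \<open>The colour is passed along the path from \<open>u\<close> to \<open>x\<close>. A swap
  along an edge is impossible only if both ends carry the same colour, and then the end nearer to
  \<open>x\<close> already has colour \<open>k\<close>.\<close>

lemma bring_colour:
  assumes "connected_in W x u" "c (\<sigma> u) = k"
  shows "\<exists>\<tau>. reach W \<sigma> \<tau> \<and> c (\<tau> x) = k"
  using assms unfolding connected_in_def
proof (induction arbitrary: \<sigma> rule: rtranclp_induct)
  case base
  then show ?case by blast
next
  case (step y z)
  show ?case
  proof (cases "c (\<sigma> y) = k")
    case True
    then show ?thesis using step by blast
  next
    case False
    have st: "step W \<sigma> (\<sigma> \<circ> transpose y z)"
      using step False by (intro stepI) auto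
    have "c ((\<sigma> \<circ> transpose y z) y) = k" using step.prems by simp
    from step.IH[of "\<sigma> \<circ> transpose y z", OF this] obtain \<tau>
      where "reach W (\<sigma> \<circ> transpose y z) \<tau>" "c (\<tau> x) = k"
      by blast
    then show ?thesis using converse_rtranclp_into_rtranclp[of "step W", OF st] by blast
  qed
qed

section \<open>Extending a full set by one position\<close>

lemma rearrange_three:
  assumes \<sigma>: "\<sigma> permutes V" "W \<subseteq> V"
    and xyz: "x \<in> W" "y \<in> W" "z \<in> W" "x \<noteq> y" "x \<noteq> z" "y \<noteq> z"
    and pqr: "p \<in> W" "q \<in> W" "r \<in> W" "p \<noteq> q" "p \<noteq> r" "q \<noteq> r"
  shows "\<exists>\<tau>. rearrangement W \<sigma> \<tau> \<and> \<tau> x = \<sigma> p \<and> \<tau> y = \<sigma> q \<and> \<tau> z = \<sigma> r"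
proof -
  \<comment> \<open>The three transpositions act from right to left, so \<open>q'\<close> and
    \<open>r'\<close> are \<open>q\<close> and \<open>r\<close> pulled back through those applied
    afterwards; thus \<open>\<pi>\<close> sends \<open>x\<close>, \<open>y\<close>, \<open>z\<close>
    to \<open>p\<close>, \<open>q\<close>, \<open>r\<close>.\<close>
  define q' where "q' = transpose x p q"
  define r' where "r' = transpose y q' (transpose x p r)"
  define \<pi> where "\<pi> = transpose x p \<circ> transpose y q' \<circ> transpose z r'"
  have q': "q' \<in> W" "q' \<noteq> x" using xyz pqr by (auto simp: q'_def transpose_def)
  have r': "r' \<in> W" "r' \<noteq> x" "r' \<noteq> y" using xyz pqr q' by (auto simp: r'_def q'_def transpose_def)
  have \<pi>: "\<pi> x = p" "\<pi> y = q" "\<pi> z = r"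
    using xyz q' r' unfolding \<pi>_def comp_def by (auto simp: q'_def r'_def)
  have "rearrangement W \<sigma> (\<sigma> \<circ> transpose x p)" (is "rearrangement _ _ ?a")
    using xyz pqr \<sigma> by (intro rearrangement_transpose)
  moreover have "rearrangement W ?a (?a \<circ> transpose y q')" (is "rearrangement _ _ ?b")
    using xyz q' \<sigma> calculation by (intro rearrangement_transpose) (auto simp: rearrangement_def)
  moreover have "rearrangement W ?b (?b \<circ> transpose z r')"
    using xyz r' \<sigma> calculation by (intro rearrangement_transpose) (auto simp: rearrangement_def)
  ultimately have "rearrangement W \<sigma> (\<sigma> \<circ> \<pi>)"
    unfolding \<pi>_def comp_assoc by (metis rearrangement_trans)
  then show ?thesis using \<pi> by (intro exI[of _ "\<sigma> \<circ> \<pi>"]) simp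
qed

text \<open>This sets the stage for \<open>full_exchange\<close>. Two persons of the other colour
  are available, and which of them stands at \<open>x\<close> is free, so one of two arrangements
  has the right parity.\<close>

lemma full_place:
  assumes W: "full W" and \<sigma>: "\<sigma> permutes V" "\<And>k. 2 \<le> num W k \<sigma>"
    and a: "a \<in> W"
    and xyz: "x \<in> W" "y \<in> W" "z \<in> W" "x \<noteq> y" "x \<noteq> z" "y \<noteq> z"
  shows "\<exists>\<tau>. reach W \<sigma> \<tau> \<and> \<tau> y = \<sigma> a \<and> c (\<tau> x) \<noteq> c (\<sigma> a) \<and> c (\<tau> z) \<noteq> c (\<sigma> a)"
proof -
  have WV: "W \<subseteq> V" using W by (simp add: full_def)
  obtain p r where pr: "p \<in> W" "r \<in> W" "p \<noteq> r" "c (\<sigma> p) = (\<not> c (\<sigma> a))" "c (\<sigma> r) = (\<not> c (\<sigma> a))"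
    using num_two_ex[OF \<sigma>(2)] by metis
  then obtain \<tau> where \<tau>: "rearrangement W \<sigma> \<tau>" "\<tau> x = \<sigma> p" "\<tau> y = \<sigma> a" "\<tau> z = \<sigma> r"
    using rearrange_three[OF \<sigma>(1) WV xyz, of p a r] a by metis
  \<comment> \<open>exchanging the two persons at \<open>x\<close> and \<open>z\<close>, which have the same colour, adjusts the parity\<close>
  let ?\<tau> = "\<tau> \<circ> transpose x z"
  have p: "\<tau> permutes V" using \<tau> by (simp add: rearrangement_def)
  have "rearrangement W \<sigma> ?\<tau>"
    using \<tau>(1) rearrangement_transpose[OF p WV xyz(1,3)] rearrangement_trans by blast
  moreover have "?\<tau> x = \<sigma> r" "?\<tau> y = \<sigma> a" "?\<tau> z = \<sigma> p"
    using \<tau> xyz by auto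
  moreover have "parity \<sigma> = parity \<tau> \<or> parity \<sigma> = parity ?\<tau>"
    using parity_transpose_same_colour[OF p xyz(5)] \<tau> pr by auto
  ultimately obtain \<upsilon> where "rearrangement W \<sigma> \<upsilon>" "parity \<sigma> = parity \<upsilon>"
      "\<upsilon> y = \<sigma> a" "c (\<upsilon> x) \<noteq> c (\<sigma> a)" "c (\<upsilon> z) \<noteq> c (\<sigma> a)"
    using \<tau> pr by metis
  then show ?thesis using W \<sigma>(2) unfolding full_def by blast
qed

text \<open>The person on \<open>w\<close> must be parked while the one at \<open>y\<close> passes
  through \<open>x\<close> to \<open>w\<close>. The parking place is \<open>z\<close>, reached
  either through \<open>x\<close> or directly from \<open>w\<close>. The persons first placed at
  \<open>x\<close> and \<open>z\<close> have the colour opposite to those at \<open>w\<close> and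
  \<open>y\<close>, which makes all the swaps legal.\<close>

lemma full_exchange:
  assumes W: "full W" and \<sigma>: "\<sigma> permutes V" "\<And>k. 2 \<le> num W k \<sigma>"
    and a: "a \<in> W" "c (\<sigma> w) = c (\<sigma> a)" and w: "w \<notin> W"
    and xyz: "x \<in> W" "y \<in> W" "z \<in> W" "y \<noteq> z" "x \<noteq> z"
    and E: "E x y" "E w x" "E x z \<or> E w z"
  shows "\<exists>\<tau>. reach (insert w W) \<sigma> \<tau> \<and> \<tau> w = \<sigma> a"
proof -
  have n: "x \<noteq> y" "w \<noteq> x" "w \<noteq> y" "w \<noteq> z" using irrefl E w xyz by auto
  obtain \<tau> where \<tau>: "reach W \<sigma> \<tau>" "\<tau> y = \<sigma> a" "c (\<tau> x) \<noteq> c (\<sigma> a)" "c (\<tau> z) \<noteq> c (\<sigma> a)"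
    using full_place[OF W \<sigma> a(1) xyz(1-3) n(1)] xyz by metis
  have WV: "W \<subseteq> V" using W by (simp add: full_def)
  have \<tau>w: "\<tau> w = \<sigma> w"
    using reach_invariants[OF \<tau>(1) \<sigma>(1) WV] w by (simp add: rearrangement_def)
  have "\<exists>\<upsilon>. reach (insert w W) \<tau> \<upsilon> \<and> \<upsilon> w = \<tau> y"
    using E(3)
  proof
    \<comment> \<open>The person from \<open>w\<close> goes to \<open>x\<close> and on to
      \<open>z\<close>; then the one from \<open>y\<close> goes to \<open>x\<close> and on to
      \<open>w\<close>.\<close>
    assume xz: "E x z"
    let ?a = "\<tau> \<circ> transpose w x"
    let ?b = "?a \<circ> transpose x z"
    let ?c = "?b \<circ> transpose x y"
    let ?d = "?c \<circ> transpose w x"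
    have 1: "step (insert w W) \<tau> ?a"
      using E \<tau> \<tau>w a xyz by (intro stepI) auto
    have 2: "step (insert w W) ?a ?b"
      using xz \<tau> \<tau>w a xyz n by (intro stepI) auto
    have 3: "step (insert w W) ?b ?c"
      using E \<tau> \<tau>w a xyz n by (intro stepI) (auto simp: transpose_def)
    have 4: "step (insert w W) ?c ?d"
      using E \<tau> \<tau>w a xyz n by (intro stepI) (auto simp: transpose_def)
    have "?d w = \<tau> y" using n xyz by (auto simp: transpose_def)
    then show ?thesis using reach_four[OF 1 2 3 4] by blast
  next
    assume wz: "E w z"
    let ?a = "\<tau> \<circ> transpose w z"
    let ?b = "?a \<circ> transpose x y"
    let ?c = "?b \<circ> transpose w x"
    have 1: "step (insert w W) \<tau> ?a"
      using wz \<tau> \<tau>w a xyz by (intro stepI) auto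
    have 2: "step (insert w W) ?a ?b"
      using E \<tau> \<tau>w a xyz n by (intro stepI) (auto simp: transpose_def)
    have 3: "step (insert w W) ?b ?c"
      using E \<tau> \<tau>w a xyz n by (intro stepI) (auto simp: transpose_def)
    have "?c w = \<tau> y" using n xyz by (auto simp: transpose_def)
    then show ?thesis using reach_three[OF 1 2 3] by blast
  qed
  then show ?thesis using \<tau> reach_mono[OF \<tau>(1), of "insert w W"] by (metis rtranclp_trans subset_insertI)
qed

lemma bring_colour_to_new:
  assumes W: "full W" and \<sigma>: "\<sigma> permutes V" and w: "w \<notin> W" "w \<in> V"
    and x: "x \<in> W" "E w x" and k: "3 \<le> num (insert w W) k \<sigma>"
  shows "\<exists>\<tau>. reach (insert w W) \<sigma> \<tau> \<and> c (\<tau> w) = k"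
proof (cases "c (\<sigma> w) = k")
  case True
  then show ?thesis by blast
next
  case False
  have WV: "W \<subseteq> V" "finite W" using W fin finite_subset by (auto simp: full_def)
  have "0 < num W k \<sigma>" using k num_insert[OF WV(2) w(1), of k \<sigma>] False by simp
  then obtain u where u: "u \<in> W" "c (\<sigma> u) = k" using num_pos_ex by blast
  then have "connected_in W x u" using W x by (simp add: full_def)
  then obtain \<tau> where \<tau>: "reach W \<sigma> \<tau>" "c (\<tau> x) = k" using bring_colour u by blast
  have "\<tau> w = \<sigma> w" using reach_invariants[OF \<tau>(1) \<sigma> WV(1)] w by (simp add: rearrangement_def)
  then have "step (insert w W) \<tau> (\<tau> \<circ> transpose w x)"
    using x \<tau> False by (intro stepI) auto
  moreover have "reach (insert w W) \<sigma> \<tau>" using \<tau> reach_mono by blast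
  ultimately have "reach (insert w W) \<sigma> (\<tau> \<circ> transpose w x)"
    by (rule rtranclp.rtrancl_into_rtrancl[of "step (insert w W)", rotated])
  then show ?thesis using \<tau> by (intro exI[of _ "\<tau> \<circ> transpose w x"]) simp
qed

lemma connected_in_insert:
  assumes conn: "\<forall>u\<in>W. \<forall>v\<in>W. connected_in W u v" and x: "x \<in> W" "E w x"
  shows "\<forall>u\<in>insert w W. \<forall>v\<in>insert w W. connected_in (insert w W) u v"
proof -
  have mono: "connected_in (insert w W) u v" if "connected_in W u v" for u v
    using that unfolding connected_in_def by (rule rtranclp_mono[THEN predicate2D, rotated]) auto
  have "connected_in (insert w W) w x" "connected_in (insert w W) x w"
    using x sym unfolding connected_in_def by auto
  moreover have trans: "connected_in (insert w W) u v"
    if "connected_in (insert w W) u y" "connected_in (insert w W) y v" for u y v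
    using that unfolding connected_in_def by (rule rtranclp_trans)
  moreover have "connected_in (insert w W) u u" for u unfolding connected_in_def by simp
  ultimately show ?thesis using conn mono x(1) by (metis insert_iff)
qed

text \<open>Both arrangements are first moved so that \<open>w\<close> carries the colour
  \<open>k\<close>, then one of them so that \<open>w\<close> carries the same person in both. The
  rest is a problem inside \<open>W\<close>, with equal parities because moves preserve
  them.\<close>

lemma full_insert:
  assumes W: "full W" and w: "w \<notin> W"
    and xyz: "x \<in> W" "y \<in> W" "z \<in> W" "y \<noteq> z" "x \<noteq> z"
    and E: "E x y" "E w x" "E x z \<or> E w z"
  shows "full (insert w W)"
proof -
  have WV: "W \<subseteq> V" "finite W" "4 \<le> card W" and conn: "\<forall>u\<in>W. \<forall>v\<in>W. connected_in W u v"
    using W fin finite_subset by (auto simp: full_def)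
  have wV: "w \<in> V" "insert w W \<subseteq> V" using E mem WV by auto
  have "reach (insert w W) \<sigma> \<tau>"
    if r: "rearrangement (insert w W) \<sigma> \<tau>" and n: "\<And>k. 2 \<le> num (insert w W) k \<sigma>"
      and par: "parity \<sigma> = parity \<tau>" for \<sigma> \<tau>
  proof -
    have p: "\<sigma> permutes V" "\<tau> permutes V" using r by (simp_all add: rearrangement_def)
    have "num (insert w W) True \<sigma> + num (insert w W) False \<sigma> = Suc (card W)"
      using num_both[of "insert w W" \<sigma>] WV w by simp
    then have "3 \<le> num (insert w W) True \<sigma> \<or> 3 \<le> num (insert w W) False \<sigma>"
      using WV(3) by linarith
    then obtain k where k: "3 \<le> num (insert w W) k \<sigma>" by blast
    obtain \<sigma>1 where \<sigma>1: "reach (insert w W) \<sigma> \<sigma>1" "c (\<sigma>1 w) = k"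
      using bring_colour_to_new[OF W p(1) w wV(1) xyz(1) E(2) k] by blast
    have "3 \<le> num (insert w W) k \<tau>" using k num_rearrangement[OF r] by simp
    then obtain \<tau>1 where \<tau>1: "reach (insert w W) \<tau> \<tau>1" "c (\<tau>1 w) = k"
      using bring_colour_to_new[OF W p(2) w wV(1) xyz(1) E(2)] by blast
    note i\<sigma> = reach_invariants[OF \<sigma>1(1) p(1) wV(2)]
    note i\<tau> = reach_invariants[OF \<tau>1(1) p(2) wV(2)]
    have r1: "rearrangement (insert w W) \<sigma>1 \<tau>1"
      using i\<sigma> i\<tau> r by (meson rearrangement_sym rearrangement_trans)
    have p1: "\<sigma>1 permutes V" using r1 by (simp add: rearrangement_def)
    \<comment> \<open>For \<open>l = k\<close> at least three persons were present and only one of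
      them is on \<open>w\<close>; persons of the other colour all stand in
      \<open>W\<close>.\<close>
    have n1: "2 \<le> num W l \<sigma>1" for l
    proof -
      have "num (insert w W) l \<sigma>1 = num (insert w W) l \<sigma>"
        using num_rearrangement[OF i\<sigma>(1)] by simp
      then show ?thesis
        using num_insert[OF WV(2) w, of l \<sigma>1] n[of l] k \<sigma>1(2) by (cases "l = k") auto
    qed
    have "\<tau>1 w \<in> \<sigma>1 ` insert w W" using rearrangement_image[OF r1] by auto
    then obtain a where a: "a \<in> insert w W" "\<tau>1 w = \<sigma>1 a" by auto
    have "\<exists>\<sigma>2. reach (insert w W) \<sigma>1 \<sigma>2 \<and> \<sigma>2 w = \<sigma>1 a"
    proof (cases "a = w")
      case True
      then show ?thesis by blast
    next
      case False
      then have "a \<in> W" "c (\<sigma>1 w) = c (\<sigma>1 a)" using a \<sigma>1 \<tau>1 by auto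
      then show ?thesis using full_exchange[OF W p1 n1 _ _ w xyz E] by blast
    qed
    then obtain \<sigma>2 where \<sigma>2: "reach (insert w W) \<sigma>1 \<sigma>2" "\<sigma>2 w = \<tau>1 w" using a by auto
    note i2 = reach_invariants[OF \<sigma>2(1) p1 wV(2)]
    have r2: "rearrangement (insert w W) \<sigma>2 \<tau>1"
      using i2 r1 by (meson rearrangement_sym rearrangement_trans)
    then have r2': "rearrangement W \<sigma>2 \<tau>1"
      using \<sigma>2(2) unfolding rearrangement_def by (metis insertE)
    have "num W l \<sigma>2 = num W l \<sigma>1" for l
    proof -
      have "num (insert w W) l \<sigma>2 = num (insert w W) l \<sigma>1" using num_rearrangement[OF i2(1)] by simp
      then show ?thesis
        using num_insert[OF WV(2) w] \<sigma>2(2) \<tau>1(2) \<sigma>1(2) by simp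
    qed
    then have "reach W \<sigma>2 \<tau>1"
      using W r2' n1 par i\<sigma>(2) i\<tau>(2) i2(2) unfolding full_def by metis
    then have "reach (insert w W) \<sigma>2 \<tau>1" using reach_mono by blast
    then show ?thesis using \<sigma>1(1) \<sigma>2(1) reach_sym[OF \<tau>1(1)] by (meson rtranclp_trans)
  qed
  moreover have "4 \<le> card (insert w W)" using WV w by simp
  ultimately show ?thesis
    using wV(2) connected_in_insert[OF conn xyz(1) E(2)] unfolding full_def by blast
qed

section \<open>The 4-cycle\<close>

lemma cycle_canonical_colours:
  assumes d: "distinct [p, q, r, t]" and E: "E p q" "E q r" "E r t" "E t p"
    and n: "\<And>k. 2 \<le> num {p, q, r, t} k \<sigma>"
  shows "\<exists>\<tau>. reach {p, q, r, t} \<sigma> \<tau> \<and> c (\<tau> p) \<and> \<not> c (\<tau> q) \<and> c (\<tau> r) \<and> \<not> c (\<tau> t)"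
proof -
  let ?W = "{p, q, r, t}"
  have num0: "num {} k \<sigma> = 0" for k by (simp add: num_def)
  define f where "f k x = (if c (\<sigma> x) = k then 1 else 0 :: nat)" for k x
  have ni: "num (insert w A) k \<sigma> = num A k \<sigma> + f k w" if "finite A" "w \<notin> A" for A w k
    using num_insert[OF that] by (simp only: f_def)
  have T: "num ?W k \<sigma> = f k p + f k q + f k r + f k t" for k
    using d num0[of k] by (simp add: ni)
  have sw: "reach ?W \<sigma> (\<sigma> \<circ> transpose u v)"
    if "u \<in> ?W" "v \<in> ?W" "E u v" "c (\<sigma> u) \<noteq> c (\<sigma> v)" for u v
    by (intro r_into_rtranclp[of "step ?W"] stepI that)
  have sw2: "reach ?W \<sigma> (\<sigma> \<circ> transpose p q \<circ> transpose r t)"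
    if "c (\<sigma> p) \<noteq> c (\<sigma> q)" "c (\<sigma> r) \<noteq> c (\<sigma> t)"
  proof -
    have "step ?W (\<sigma> \<circ> transpose p q) (\<sigma> \<circ> transpose p q \<circ> transpose r t)"
      using that d E by (intro stepI) auto
    then show ?thesis
      using rtranclp.rtrancl_into_rtrancl[of "step ?W", OF sw[of p q]] that E by simp
  qed
  \<comment> \<open>There are exactly two persons of each colour, hence six patterns. The opposite
    alternation needs two disjoint swaps, each of the last four patterns a single one.\<close>
  consider "c (\<sigma> p)" "\<not> c (\<sigma> q)" "c (\<sigma> r)" "\<not> c (\<sigma> t)"
    | "\<not> c (\<sigma> p)" "c (\<sigma> q)" "\<not> c (\<sigma> r)" "c (\<sigma> t)"
    | "c (\<sigma> p)" "c (\<sigma> q)" "\<not> c (\<sigma> r)" "\<not> c (\<sigma> t)"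
    | "\<not> c (\<sigma> p)" "\<not> c (\<sigma> q)" "c (\<sigma> r)" "c (\<sigma> t)"
    | "c (\<sigma> p)" "\<not> c (\<sigma> q)" "\<not> c (\<sigma> r)" "c (\<sigma> t)"
    | "\<not> c (\<sigma> p)" "c (\<sigma> q)" "c (\<sigma> r)" "\<not> c (\<sigma> t)"
    using n[of True] n[of False] unfolding T f_def
    by (cases "c (\<sigma> p)"; cases "c (\<sigma> q)"; cases "c (\<sigma> r)"; cases "c (\<sigma> t)") simp_all
  then show ?thesis
  proof cases
    case 1
    then show ?thesis by blast
  next
    case 2
    then show ?thesis using d by (intro exI[of _ "\<sigma> \<circ> transpose p q \<circ> transpose r t"] conjI sw2) auto
  next
    case 3
    then show ?thesis using d E by (intro exI[of _ "\<sigma> \<circ> transpose q r"] conjI sw) auto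
  next
    case 4
    then show ?thesis using d E by (intro exI[of _ "\<sigma> \<circ> transpose t p"] conjI sw) auto
  next
    case 5
    then show ?thesis using d E by (intro exI[of _ "\<sigma> \<circ> transpose r t"] conjI sw) auto
  next
    case 6
    then show ?thesis using d E by (intro exI[of _ "\<sigma> \<circ> transpose p q"] conjI sw) auto
  qed
qed

text \<open>Swapping along one pair of opposite edges and then along the other rotates all persons
  by two places. The colours alternate before each pair of swaps, so these are legal.\<close>

lemma cycle_double_swap:
  assumes d: "distinct [p, q, r, t]" and E: "E p q" "E q r" "E r t" "E t p"
    and c: "c (\<sigma> p)" "\<not> c (\<sigma> q)" "c (\<sigma> r)" "\<not> c (\<sigma> t)"
  shows "reach {p, q, r, t} \<sigma> (\<sigma> \<circ> transpose p r \<circ> transpose q t)"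
proof -
  let ?W = "{p, q, r, t}"
  let ?a = "\<sigma> \<circ> transpose p q"
  let ?b = "?a \<circ> transpose r t"
  let ?c = "?b \<circ> transpose q r"
  let ?d = "?c \<circ> transpose t p"
  have 1: "step ?W \<sigma> ?a" using E c by (intro stepI) auto
  have 2: "step ?W ?a ?b" using E c d by (intro stepI) auto
  have 3: "step ?W ?b ?c" using E c d by (intro stepI) auto
  have 4: "step ?W ?c ?d" using E c d by (intro stepI) (auto simp: transpose_def)
  have "?d = \<sigma> \<circ> transpose p r \<circ> transpose q t"
    using d by (auto simp: fun_eq_iff transpose_def)
  then show ?thesis using reach_four[OF 1 2 3 4] by simp
qed

text \<open>Once both colour patterns alternate, the arrangements differ at most by exchanging the
  persons at \<open>p\<close> and \<open>r\<close>, those at \<open>q\<close> and \<open>t\<close>,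
  or both. Equal parity rules out a single exchange; the double one is
  \<open>cycle_double_swap\<close>.\<close>

lemma full_cycle:
  assumes d: "distinct [p, q, r, t]" and E: "E p q" "E q r" "E r t" "E t p"
  shows "full {p, q, r, t}"
proof -
  let ?W = "{p, q, r, t}"
  have WV: "?W \<subseteq> V" using E mem by auto
  have "reach ?W \<sigma> \<tau>"
    if r: "rearrangement ?W \<sigma> \<tau>" and n: "\<And>k. 2 \<le> num ?W k \<sigma>" and par: "parity \<sigma> = parity \<tau>" for \<sigma> \<tau>
  proof -
    have p: "\<sigma> permutes V" "\<tau> permutes V" using r by (simp_all add: rearrangement_def)
    obtain \<sigma>1 where \<sigma>1: "reach ?W \<sigma> \<sigma>1" "c (\<sigma>1 p)" "\<not> c (\<sigma>1 q)" "c (\<sigma>1 r)" "\<not> c (\<sigma>1 t)"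
      using cycle_canonical_colours[OF d E n] by blast
    have "2 \<le> num ?W k \<tau>" for k using n[of k] num_rearrangement[OF r] by simp
    then obtain \<tau>1 where \<tau>1: "reach ?W \<tau> \<tau>1" "c (\<tau>1 p)" "\<not> c (\<tau>1 q)" "c (\<tau>1 r)" "\<not> c (\<tau>1 t)"
      using cycle_canonical_colours[OF d E] by blast
    note i\<sigma> = reach_invariants[OF \<sigma>1(1) p(1) WV]
    note i\<tau> = reach_invariants[OF \<tau>1(1) p(2) WV]
    have r1: "rearrangement ?W \<sigma>1 \<tau>1"
      using i\<sigma> i\<tau> r by (meson rearrangement_sym rearrangement_trans)
    then have p1: "\<sigma>1 permutes V" "\<tau>1 permutes V" by (simp_all add: rearrangement_def)
    have im: "{\<tau>1 p, \<tau>1 q, \<tau>1 r, \<tau>1 t} = {\<sigma>1 p, \<sigma>1 q, \<sigma>1 r, \<sigma>1 t}"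
      using rearrangement_image[OF r1] by simp
    have inj: "\<tau>1 p \<noteq> \<tau>1 r" "\<tau>1 q \<noteq> \<tau>1 t"
      using permutes_inj[OF p1(2)] d by (auto dest: injD)
    have A: "\<tau>1 p = \<sigma>1 p \<and> \<tau>1 r = \<sigma>1 r \<or> \<tau>1 p = \<sigma>1 r \<and> \<tau>1 r = \<sigma>1 p"
      using im inj \<sigma>1 \<tau>1 by (metis insert_iff singletonD)
    have B: "\<tau>1 q = \<sigma>1 q \<and> \<tau>1 t = \<sigma>1 t \<or> \<tau>1 q = \<sigma>1 t \<and> \<tau>1 t = \<sigma>1 q"
      using im inj \<sigma>1 \<tau>1 by (metis insert_iff singletonD)
    have off: "\<tau>1 v = \<sigma>1 v" if "v \<noteq> p" "v \<noteq> q" "v \<noteq> r" "v \<noteq> t" for v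
      using r1 that by (simp add: rearrangement_def)
    have pr: "parity (\<sigma>1 \<circ> transpose p r) \<noteq> parity \<sigma>1" "parity (\<sigma>1 \<circ> transpose q t) \<noteq> parity \<sigma>1"
      using parity_transpose_same_colour[OF p1(1)] d \<sigma>1 by auto
    have par1: "parity \<tau>1 = parity \<sigma>1" using par i\<sigma>(2) i\<tau>(2) by simp
    have "\<tau>1 = \<upsilon>" if "\<And>v. v \<in> {p, q, r, t} \<Longrightarrow> \<tau>1 v = \<upsilon> v"
        "\<And>v. v \<notin> {p, q, r, t} \<Longrightarrow> \<sigma>1 v = \<upsilon> v" for \<upsilon>
    proof
      show "\<tau>1 v = \<upsilon> v" for v using that off by (cases "v \<in> {p, q, r, t}") auto
    qed
    note eq = this
    consider "\<tau>1 = \<sigma>1" | "\<tau>1 = \<sigma>1 \<circ> transpose p r" | "\<tau>1 = \<sigma>1 \<circ> transpose q t"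
      | "\<tau>1 = \<sigma>1 \<circ> transpose p r \<circ> transpose q t"
      using A B
    proof (elim disjE conjE, goal_cases)
      case 1
      show ?case by (rule 1(1), rule eq) (use 1(5-) in auto)
    next
      case 2
      show ?case by (rule 2(3), rule eq) (use 2(5-) d in \<open>auto simp: transpose_def\<close>)
    next
      case 3
      show ?case by (rule 3(2), rule eq) (use 3(5-) d in \<open>auto simp: transpose_def\<close>)
    next
      case 4
      show ?case by (rule 4(4), rule eq) (use 4(5-) d in \<open>auto simp: transpose_def\<close>)
    qed
    then have "reach ?W \<sigma>1 \<tau>1"
    proof cases
      case 1
      then show ?thesis by simp
    next
      case 4
      then show ?thesis using cycle_double_swap[OF d E \<sigma>1(2-5)] by simp
    qed (use pr par1 in auto)
    then show ?thesis using \<sigma>1(1) reach_sym[OF \<tau>1(1)] by (meson rtranclp_trans)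
  qed
  moreover have "\<forall>u\<in>?W. \<forall>v\<in>?W. connected_in ?W u v"
  proof -
    have "\<forall>u\<in>{p}. \<forall>v\<in>{p}. connected_in {p} u v" by (simp add: connected_in_def)
    from connected_in_insert[OF this, of p q]
    have "\<forall>u\<in>{q, p}. \<forall>v\<in>{q, p}. connected_in {q, p} u v" using E sym by blast
    from connected_in_insert[OF this, of p t]
    have "\<forall>u\<in>{t, q, p}. \<forall>v\<in>{t, q, p}. connected_in {t, q, p} u v" using E sym by blast
    from connected_in_insert[OF this, of q r]
    have "\<forall>u\<in>{r, t, q, p}. \<forall>v\<in>{r, t, q, p}. connected_in {r, t, q, p} u v" using E sym by blast
    then show ?thesis by (simp add: insert_commute)
  qed
  moreover have "card ?W = 4" using d by simp
  ultimately show ?thesis using WV unfolding full_def by auto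
qed

text \<open>A maximal full set cannot be enlarged by \<open>full_insert\<close>. If it contains a
  cycle through \<open>u0\<close> and \<open>u1\<close> on the same side, it contains all their
  neighbours, and common neighbours with these two attach any further \<open>v\<close> on that
  side.\<close>

lemma full_all:
  assumes common: "\<And>u v. u \<in> V \<Longrightarrow> v \<in> V \<Longrightarrow> s u = s v \<Longrightarrow> \<exists>w. E u w \<and> E v w"
    and d: "distinct [p, q, r, t]" and E: "E p q" "E q r" "E r t" "E t p"
  shows "full V"
proof -
  define F where "F = {W. full W \<and> {p, q, r, t} \<subseteq> W}"
  have "F \<subseteq> Pow V" by (auto simp: F_def full_def)
  then have "finite F" using fin by (meson finite_Pow_iff finite_subset)
  moreover have "{p, q, r, t} \<in> F" using full_cycle[OF d E] by (simp add: F_def)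
  ultimately obtain W where W: "W \<in> F" "\<And>W'. W' \<in> F \<Longrightarrow> W \<subseteq> W' \<Longrightarrow> W = W'"
    using finite_has_maximal[of F] by blast
  then have full: "full W" and sub: "{p, q, r, t} \<subseteq> W" by (auto simp: F_def)
  have ext: "w \<in> W" if "x \<in> W" "y \<in> W" "z \<in> W" "y \<noteq> z" "x \<noteq> z" "E x y" "E w x" "E x z \<or> E w z"
    for w x y z
  proof (rule ccontr)
    assume w: "w \<notin> W"
    have "insert w W \<in> F" using full_insert[OF full w that] sub by (auto simp: F_def)
    then show False using W(2)[of "insert w W"] w by auto
  qed
  have key: "v \<in> W"
    if v: "v \<in> V" "s v = s u0" and u: "distinct [u0, y0, u1, y1]" "{u0, y0, u1, y1} \<subseteq> W"
      and e: "E u0 y0" "E y0 u1" "E u1 y1" "E y1 u0" for v u0 y0 u1 y1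
  proof -
    \<comment> \<open>Both \<open>u0\<close> and \<open>u1\<close> have the two neighbours
      \<open>y0\<close> and \<open>y1\<close> in \<open>W\<close>, so anything adjacent to them can
      be added.\<close>
    have nb: "y \<in> W" if "E u0 y \<or> E u1 y" for y
      using that
    proof
      assume "E u0 y"
      then show ?thesis using ext[of u0 y0 y1 y] u e sym by auto
    next
      assume "E u1 y"
      then show ?thesis using ext[of u1 y0 y1 y] u e sym by auto
    qed
    have "s u1 = s u0" using side e(1,2) by metis
    then obtain z z' where z: "E v z" "E u0 z" "E v z'" "E u1 z'"
      using common[of v u0] common[of v u1] v e mem by metis
    show ?thesis
    \<comment> \<open>If \<open>z = z'\<close>, this contact vertex has the neighbours
      \<open>u0\<close> and \<open>u1\<close> in \<open>W\<close>; otherwise \<open>v\<close> itself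
      has two neighbours in \<open>W\<close>.\<close>
    proof (cases "z = z'")
      case True
      then show ?thesis using ext[of z u0 u1 v] z u nb sym irrefl by auto
    next
      case False
      have "u0 \<noteq> z'" using z(3) side v(2) by metis
      then show ?thesis using ext[of z u0 z' v] False z u nb sym by auto
    qed
  qed
  have "V \<subseteq> W"
  proof
    fix v assume v: "v \<in> V"
    have "s v = s p \<or> s v = s q" using side E(1) by blast
    then show "v \<in> W"
    proof
      assume "s v = s p"
      then show ?thesis using key[of v p q r t] v d sub E by blast
    next
      assume "s v = s q"
      then show ?thesis using key[of v q r t p] v d sub E by auto
    qed
  qed
  moreover have "W \<subseteq> V" using full by (simp add: full_def)
  ultimately show ?thesis using full by simp
qed

end

section \<open>Counting components\<close>

text \<open>An invariant is constant on components, so reading it off representatives maps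
  components onto its values. If equal values imply reachability, values determine components in
  turn.\<close>

lemma num_components_invariant:
  assumes G: "pair_graph G" and f: "\<And>u v. (u, v) \<in> parcs G \<Longrightarrow> f u = f v"
  shows "card (f ` pverts G) \<le> num_components G"
    and "(\<And>u v. u \<in> pverts G \<Longrightarrow> v \<in> pverts G \<Longrightarrow> f u = f v \<Longrightarrow> u \<rightarrow>\<^sup>*\<^bsub>with_proj G\<^esub> v) \<Longrightarrow>
      num_components G \<le> card (f ` pverts G)"
proof -
  interpret pair_graph G by (rule G)
  have num: "num_components G = card (scc_of ` pverts G)"
    using card_sccs_verts sccs_verts_conv_scc_of by (simp add: num_components_def)
  have fr: "f u = f v" if "u \<rightarrow>\<^sup>*\<^bsub>with_proj G\<^esub> v" for u v
    using that by (induction rule: reachable_induct) (auto dest: f)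
  define g where "g S = f (SOME x. x \<in> S)" for S
  have "f u = g (scc_of u)" if "u \<in> pverts G" for u
  proof -
    have "(SOME x. x \<in> scc_of u) \<in> scc_of u"
      using that in_scc_of_self[of u] by (intro someI_ex[of "\<lambda>x. x \<in> scc_of u"]) auto
    then show ?thesis using fr by (auto simp: g_def scc_of_def)
  qed
  then have "f ` pverts G \<subseteq> g ` scc_of ` pverts G" by auto
  then show "card (f ` pverts G) \<le> num_components G"
    unfolding num by (rule surj_card_le[rotated]) (simp add: pair_finite_verts)
  assume r: "\<And>u v. u \<in> pverts G \<Longrightarrow> v \<in> pverts G \<Longrightarrow> f u = f v \<Longrightarrow> u \<rightarrow>\<^sup>*\<^bsub>with_proj G\<^esub> v"
  define h where "h y = scc_of (SOME x. x \<in> pverts G \<and> f x = y)" for y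
  have "scc_of u = h (f u)" if u: "u \<in> pverts G" for u
  proof -
    let ?x = "SOME x. x \<in> pverts G \<and> f x = f u"
    have "?x \<in> pverts G \<and> f ?x = f u"
      using u by (intro someI_ex[of "\<lambda>x. x \<in> pverts G \<and> f x = f u"]) auto
    then have "u \<in> scc_of ?x" using r u by (auto simp: scc_of_def)
    then show ?thesis using scc_of_eq by (simp add: h_def)
  qed
  then have "scc_of ` pverts G \<subseteq> h ` f ` pverts G" by auto
  then show "num_components G \<le> card (f ` pverts G)"
    unfolding num by (rule surj_card_le[rotated]) (simp add: pair_finite_verts)
qed

text \<open>On a common vertex set the bijections become permutations and so acquire a sign.
  Restriction replaces the identity outside \<open>V\<close> by the default value of extensional
  functions.\<close>

lemma vertex_bijections_permutes:
  assumes "pverts X = V" "pverts Y = V"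
  shows "vertex_bijections X Y = (\<lambda>p. restrict p V) ` {p. p permutes V}"
proof (intro set_eqI iffI)
  fix \<sigma> assume "\<sigma> \<in> vertex_bijections X Y"
  then have \<sigma>: "\<sigma> \<in> extensional V" "bij_betw \<sigma> V V"
    using assms by (auto simp: vertex_bijections_def)
  let ?p = "\<lambda>x. if x \<in> V then \<sigma> x else x"
  have "bij_betw ?p V V" using \<sigma>(2) by (simp cong: bij_betw_cong)
  then have "?p permutes V" by (intro bij_imp_permutes) auto
  moreover have "\<sigma> = restrict ?p V" using \<sigma>(1) by (auto simp: extensional_def restrict_def fun_eq_iff)
  ultimately show "\<sigma> \<in> (\<lambda>p. restrict p V) ` {p. p permutes V}" by blast
next
  fix \<sigma> assume "\<sigma> \<in> (\<lambda>p. restrict p V) ` {p. p permutes V}"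
  then show "\<sigma> \<in> vertex_bijections X Y"
    using assms by (auto simp: vertex_bijections_def bij_betw_restrict_eq permutes_imp_bij)
qed

lemma restrict_permutes_inj:
  assumes "p permutes V" "q permutes V" "restrict p V = restrict q V"
  shows "p = q"
proof
  show "p x = q x" for x
    using assms(1,2) fun_cong[OF assms(3), of x] by (cases "x \<in> V") (simp_all add: permutes_not_in)
qed

lemma FS_arc_permutes:
  assumes X: "pair_graph X" and V: "pverts X = V" "pverts Y = V"
    and p: "p permutes V" and q: "q permutes V"
  shows "(restrict p V, restrict q V) \<in> parcs (FS X Y) \<longleftrightarrow>
    (\<exists>a b. (a, b) \<in> parcs X \<and> (p a, p b) \<in> parcs Y \<and> q = p \<circ> transpose a b)"
    (is "?L \<longleftrightarrow> ?R")
proof -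
  interpret pair_graph X by (rule X)
  have inV: "a \<in> V" "b \<in> V" if "(a, b) \<in> parcs X" for a b
    using that V(1) in_arcsD1 in_arcsD2 by auto
  have vb: "restrict p V \<in> vertex_bijections X Y" "restrict q V \<in> vertex_bijections X Y"
    using vertex_bijections_permutes[OF V] p q by auto
  show ?thesis
  proof
    assume ?L
    then obtain a b where ab: "(a, b) \<in> parcs X" "(restrict p V a, restrict p V b) \<in> parcs Y"
        "restrict p V a = restrict q V b" "restrict p V b = restrict q V a"
        "\<forall>c \<in> V - {a, b}. restrict p V c = restrict q V c"
      by (auto simp: FS_def V)
    have "q x = (p \<circ> transpose a b) x" for x
      using ab inV[OF ab(1)] p q by (cases "x \<in> V") (auto simp: transpose_def permutes_not_in)
    then show ?R using ab inV[OF ab(1)] by (intro exI[of _ a] exI[of _ b]) auto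
  next
    assume ?R
    then obtain a b where ab: "(a, b) \<in> parcs X" "(p a, p b) \<in> parcs Y" "q = p \<circ> transpose a b"
      by blast
    have "(restrict p V a, restrict p V b) \<in> parcs Y" "restrict p V a = restrict q V b"
        "restrict p V b = restrict q V a" "\<forall>c \<in> pverts X - {a, b}. restrict p V c = restrict q V c"
      using ab inV[OF ab(1)] V by (auto simp: transpose_def)
    then have "\<exists>a b. (a, b) \<in> parcs X \<and> (restrict p V a, restrict p V b) \<in> parcs Y \<and>
        restrict p V a = restrict q V b \<and> restrict p V b = restrict q V a \<and>
        (\<forall>c \<in> pverts X - {a, b}. restrict p V c = restrict q V c)"
      using ab(1) by blast
    then show ?L
      unfolding FS_def using vb by (simp del: restrict_apply)
  qed
qed

lemma num_components_FS_invariant: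
  assumes X: "pair_graph X" and Y: "pair_graph Y" and V: "pverts X = V" "pverts Y = V"
    and f: "\<And>p a b. p permutes V \<Longrightarrow> (a, b) \<in> parcs X \<Longrightarrow> (p a, p b) \<in> parcs Y \<Longrightarrow>
      f (p \<circ> transpose a b) = f p"
  shows "card (f ` {p. p permutes V}) \<le> num_components (FS X Y)"
    and "(\<And>p q. p permutes V \<Longrightarrow> q permutes V \<Longrightarrow> f p = f q \<Longrightarrow>
        (\<lambda>p q. \<exists>a b. (a, b) \<in> parcs X \<and> (p a, p b) \<in> parcs Y \<and> q = p \<circ> transpose a b)\<^sup>*\<^sup>* p q) \<Longrightarrow>
      num_components (FS X Y) \<le> card (f ` {p. p permutes V})"
proof -
  interpret X: pair_graph X by (rule X)
  interpret FS: pair_graph "FS X Y" by (rule pair_graph_FS[OF X Y])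
  \<comment> \<open>By \<open>restrict_permutes_inj\<close> the permutation behind a vertex of
    \<open>FS X Y\<close> is unique, so \<open>f\<close> carries over to vertices.\<close>
  define F where "F \<sigma> = f (THE p. p permutes V \<and> restrict p V = \<sigma>)" for \<sigma>
  have F: "F (restrict p V) = f p" if "p permutes V" for p
  proof -
    have "(THE q. q permutes V \<and> restrict q V = restrict p V) = p"
      using that restrict_permutes_inj by blast
    then show ?thesis by (simp add: F_def)
  qed
  have verts: "pverts (FS X Y) = (\<lambda>p. restrict p V) ` {p. p permutes V}"
    using vertex_bijections_permutes[OF V] by (simp add: FS_def)
  have im: "F ` pverts (FS X Y) = f ` {p. p permutes V}"
    unfolding verts image_image using F by auto
  have inv: "F \<sigma> = F \<tau>" if "(\<sigma>, \<tau>) \<in> parcs (FS X Y)" for \<sigma> \<tau>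
  proof -
    have "\<sigma> \<in> pverts (FS X Y)" "\<tau> \<in> pverts (FS X Y)"
      using that FS.in_arcsD1 FS.in_arcsD2 by auto
    then obtain p q where pq: "p permutes V" "q permutes V" "\<sigma> = restrict p V" "\<tau> = restrict q V"
      unfolding verts by auto
    then show ?thesis
      using that FS_arc_permutes[OF X V pq(1,2)] f[OF pq(1)] F[OF pq(1)] F[OF pq(2)] by auto
  qed
  note ge = num_components_invariant[where f = F, OF pair_graph_FS[OF X Y] inv]
  show "card (f ` {p. p permutes V}) \<le> num_components (FS X Y)"
    using ge(1) im by simp
  let ?R = "\<lambda>p q. \<exists>a b. (a, b) \<in> parcs X \<and> (p a, p b) \<in> parcs Y \<and> q = p \<circ> transpose a b"
  assume r: "\<And>p q. p permutes V \<Longrightarrow> q permutes V \<Longrightarrow> f p = f q \<Longrightarrow> ?R\<^sup>*\<^sup>* p q"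
  have reach: "q permutes V \<and> restrict p V \<rightarrow>\<^sup>*\<^bsub>with_proj (FS X Y)\<^esub> restrict q V"
    if "?R\<^sup>*\<^sup>* p q" "p permutes V" for p q
    using that
  proof (induction rule: rtranclp_induct)
    case base
    then have "restrict p V \<in> pverts (FS X Y)" unfolding verts by blast
    then show ?case using base by (intro conjI FS.reachable_refl)
  next
    case (step q q')
    then obtain a b where ab: "(a, b) \<in> parcs X" "(q a, q b) \<in> parcs Y" "q' = q \<circ> transpose a b"
      by blast
    have q: "q permutes V" using step by blast
    have "a \<in> V" "b \<in> V" using ab V(1) X.in_arcsD1 X.in_arcsD2 by auto
    then have q': "q' permutes V" using q ab by (simp add: permutes_compose permutes_swap_id)
    then have adj: "(restrict q V, restrict q' V) \<in> parcs (FS X Y)"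
      using FS_arc_permutes[OF X V q q'] ab by blast
    have "restrict p V \<rightarrow>\<^sup>*\<^bsub>with_proj (FS X Y)\<^esub> restrict q V"
      by (rule step.IH[OF step.prems, THEN conjunct2])
    from q' FS.reachable_adj_trans[OF this adj] show ?case by (rule conjI)
  qed
  have "\<sigma> \<rightarrow>\<^sup>*\<^bsub>with_proj (FS X Y)\<^esub> \<tau>"
    if st: "\<sigma> \<in> pverts (FS X Y)" "\<tau> \<in> pverts (FS X Y)" "F \<sigma> = F \<tau>" for \<sigma> \<tau>
  proof -
    obtain p q where pq: "p permutes V" "q permutes V" "\<sigma> = restrict p V" "\<tau> = restrict q V"
      using st(1,2) unfolding verts by blast
    then have "f p = f q" using F st(3) by simp
    then show ?thesis unfolding pq(3,4) using reach[OF r[OF pq(1,2)] pq(1)] by blast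
  qed
  then show "num_components (FS X Y) \<le> card (f ` {p. p permutes V})"
    using ge(2) im by simp
qed

section \<open>Edge-subgraphs of \<open>K_rr r\<close>\<close>

lemma pverts_K_rr: "pverts (K_rr r) = Inl ` {..<r} \<union> Inr ` {..<r}"
  by (simp add: K_rr_def)

lemma parcs_K_rr:
  "(x, y) \<in> parcs (K_rr r) \<longleftrightarrow> x \<in> pverts (K_rr r) \<and> y \<in> pverts (K_rr r) \<and> isl x \<noteq> isl y"
  by (cases x; cases y) (auto simp: K_rr_def)

lemma card_side_K_rr: "card {w \<in> pverts (K_rr r). isl w = b} = r"
proof -
  have "{w \<in> pverts (K_rr r). isl w = b} = (if b then Inl ` {..<r} else Inr ` {..<r})"
    by (auto simp: pverts_K_rr)
  then show ?thesis by (simp add: card_image)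
qed

lemma finite_K_rr: "finite (pverts (K_rr r))"
  by (simp add: pverts_K_rr)

lemma pair_graph_K_rr: "pair_graph (K_rr r)"
proof
  show "finite (pverts (K_rr r))" by (rule finite_K_rr)
  show "finite (parcs (K_rr r))" by (simp add: K_rr_def)
  show "symmetric (with_proj (K_rr r))"
    by (auto simp: symmetric_def parcs_K_rr intro!: symI)
qed (auto simp: parcs_K_rr)

lemma edge_subgraph_K_rrD:
  assumes "edge_subgraph X (K_rr r)"
  shows "pair_graph X" "pverts X = pverts (K_rr r)" "parcs X \<subseteq> parcs (K_rr r)"
  using assms by (auto simp: edge_subgraph_def spanning_def subgraph_def)

lemma out_degree_pair: "out_degree (with_proj X) v = card {w. (v, w) \<in> parcs X}"
proof -
  have "out_arcs (with_proj X) v = Pair v ` {w. (v, w) \<in> parcs X}"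
    by (auto simp: out_arcs_def)
  moreover have "card (Pair v ` {w. (v, w) \<in> parcs X}) = card {w. (v, w) \<in> parcs X}"
    by (intro card_image inj_onI) simp
  ultimately show ?thesis by (simp only: out_degree_def)
qed

lemma bipartite_swaps_subgraph:
  assumes "edge_subgraph X (K_rr r)"
  shows "bipartite_swaps (pverts (K_rr r)) (\<lambda>u v. (u, v) \<in> parcs X) isl"
proof
  note X = edge_subgraph_K_rrD[OF assms]
  interpret X: pair_graph X by (rule X(1))
  show "finite (pverts (K_rr r))" by (rule finite_K_rr)
  show "(v, u) \<in> parcs X" if "(u, v) \<in> parcs X" for u v
    using arcs_ends_symmetric[OF X.pair_sym_arcs] that by simp
  show "u \<in> pverts (K_rr r)" "isl u \<noteq> isl v" if "(u, v) \<in> parcs X" for u v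
    using that X(3) parcs_K_rr by blast+
qed

text \<open>Here \<open>isl\<close> is both side and colour. Moves preserve \<open>parity\<close>
  and fullness joins arrangements of equal parity, so components correspond to the values of
  \<open>parity\<close>.\<close>

lemma two_components_if_full:
  fixes r :: nat
  assumes r: "2 \<le> r" and X: "edge_subgraph X (K_rr r)"
    and full: "bipartite_swaps.full (pverts (K_rr r)) (\<lambda>u v. (u, v) \<in> parcs X) isl isl (pverts (K_rr r))"
  shows "num_components (FS X (K_rr r)) = 2"
proof -
  let ?V = "pverts (K_rr r)"
  let ?E = "\<lambda>u v. (u, v) \<in> parcs X"
  interpret bipartite_swaps ?V ?E isl isl by (rule bipartite_swaps_subgraph[OF X])
  note XD = edge_subgraph_K_rrD[OF X]
  have inv: "parity (p \<circ> transpose a b) = parity p"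
    if "p permutes ?V" "(a, b) \<in> parcs X" "(p a, p b) \<in> parcs (K_rr r)" for p a b
    using that parcs_K_rr by (intro parity_transpose_edge) auto
  \<comment> \<open>The identity shows \<open>r\<close> persons of each colour, and rearranging them
    keeps this number.\<close>
  have n: "2 \<le> num ?V k p" if "p permutes ?V" for p k
  proof -
    have "num ?V k p = num ?V k id"
      using that by (intro num_rearrangement) (simp add: rearrangement_def permutes_id permutes_not_in)
    then show ?thesis using r card_side_K_rr[of r k] by (simp add: num_def)
  qed
  let ?R = "\<lambda>p q. \<exists>a b. (a, b) \<in> parcs X \<and> (p a, p b) \<in> parcs (K_rr r) \<and> q = p \<circ> transpose a b"
  have conn: "?R\<^sup>*\<^sup>* p q" if p: "p permutes ?V" and q: "q permutes ?V" and par: "parity p = parity q" for p q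
  proof -
    have "rearrangement ?V p q" using p q by (simp add: rearrangement_def permutes_not_in)
    then have "reach ?V p q" using full n[OF p] par by (simp add: full_def)
    then have "?R\<^sup>*\<^sup>* p q \<and> q permutes ?V"
    proof (induction rule: rtranclp_induct)
      case base
      then show ?case using p by simp
    next
      case (step q q')
      then obtain u v where uv: "u \<in> ?V" "v \<in> ?V" "(u, v) \<in> parcs X" "isl (q u) \<noteq> isl (q v)"
          "q' = q \<circ> transpose u v"
        by (auto simp: step_def)
      have q: "q permutes ?V" using step by blast
      have "(q u, q v) \<in> parcs (K_rr r)" using uv permutes_in_image[OF q] by (simp add: parcs_K_rr)
      then have "?R q q'" using uv by blast
      moreover have "q' permutes ?V" using uv q by (simp add: permutes_compose permutes_swap_id)
      ultimately show ?case using step rtranclp.rtrancl_into_rtrancl[of ?R p q q'] by blast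
    qed
    then show ?thesis by blast
  qed
  \<comment> \<open>Exchanging two left persons flips the parity of the identity, so both values
    occur.\<close>
  have "parity ` {p. p permutes ?V} = UNIV"
  proof -
    let ?t = "transpose (Inl 0) (Inl 1) :: nat + nat \<Rightarrow> nat + nat"
    have "Inl 0 \<in> ?V" "Inl 1 \<in> ?V" using r by (auto simp: pverts_K_rr)
    then have "?t permutes ?V" by (rule permutes_swap_id)
    moreover have "parity ?t \<noteq> parity id"
      using parity_transpose_same_colour[of id "Inl 0" "Inl 1"] by (simp add: permutes_id)
    moreover have "id permutes ?V" by (rule permutes_id)
    ultimately have "{parity ?t, parity id} \<subseteq> parity ` {p. p permutes ?V}" by blast
    moreover have "{parity ?t, parity id} = UNIV" using \<open>parity ?t \<noteq> parity id\<close> by auto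
    ultimately show ?thesis by blast
  qed
  then have "card (parity ` {p. p permutes ?V}) = 2" by simp
  moreover have "card (parity ` {p. p permutes ?V}) \<le> num_components (FS X (K_rr r))"
    by (rule num_components_FS_invariant(1)[OF XD(1) pair_graph_K_rr XD(2) refl, of parity, OF inv])
  moreover have "num_components (FS X (K_rr r)) \<le> card (parity ` {p. p permutes ?V})"
    by (rule num_components_FS_invariant(2)[OF XD(1) pair_graph_K_rr XD(2) refl, of parity, OF inv conn])
  ultimately show ?thesis by simp
qed

section \<open>The upper bound\<close>

lemma degree_bound:
  assumes X: "edge_subgraph X (K_rr r)" and d: "d \<le> min_degree X" and v: "v \<in> pverts (K_rr r)"
  shows "d \<le> card {w. (v, w) \<in> parcs X}"
proof -
  have "min_degree X \<le> out_degree (with_proj X) v"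
    unfolding min_degree_def using edge_subgraph_K_rrD(2)[OF X] v finite_K_rr by (intro Min_le) auto
  then show ?thesis using d by (simp add: out_degree_pair)
qed

lemma forces_two_components_if:
  assumes r: "2 \<le> r" and d: "r < 2 * d" "r \<le> d * (d - 1)"
  shows "forces_two_components r d"
  unfolding forces_two_components_def
proof (intro allI impI, elim conjE)
  fix X assume X: "edge_subgraph X (K_rr r)" and deg: "d \<le> min_degree X"
  let ?V = "pverts (K_rr r)"
  let ?E = "\<lambda>u v. (u, v) \<in> parcs X"
  interpret bipartite_swaps ?V ?E isl isl by (rule bipartite_swaps_subgraph[OF X])
  define N where "N v = {w. (v, w) \<in> parcs X}" for v
  have N: "d \<le> card (N v)" if "v \<in> ?V" for v
    using degree_bound[OF X deg that] by (simp add: N_def)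
  have NV: "N v \<subseteq> {w \<in> ?V. isl w = (\<not> isl v)}" for v
    using side mem2 unfolding N_def by blast
  have fN: "finite (N v)" for v by (rule finite_subset[OF NV]) (simp add: finite_K_rr)
  \<comment> \<open>Disjoint neighbourhoods would need \<open>2 * d\<close> vertices on a side that
    has only \<open>r\<close>.\<close>
  have common: "\<exists>w. ?E u w \<and> ?E v w" if uv: "u \<in> ?V" "v \<in> ?V" "isl u = isl v" for u v
  proof (rule ccontr)
    assume "\<not> ?thesis"
    then have "N u \<inter> N v = {}" by (auto simp: N_def)
    then have "card (N u \<union> N v) = card (N u) + card (N v)" using fN by (simp add: card_Un_disjoint)
    moreover have "card (N u \<union> N v) \<le> card {w \<in> ?V. isl w = (\<not> isl u)}"
      using NV[of u] NV[of v] uv finite_K_rr by (intro card_mono) auto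
    ultimately show False using N[OF uv(1)] N[OF uv(2)] d(1) by (simp add: card_side_K_rr)
  qed
  define u where "u = (Inl 0 :: nat + nat)"
  have u: "u \<in> ?V" "isl u" using r by (auto simp: u_def pverts_K_rr)
  \<comment> \<open>Otherwise no 4-cycle passes through \<open>u\<close>: the sets
    \<open>N y - {u}\<close> are pairwise disjoint, and at least \<open>d * (d - 1)\<close> vertices
    would fit among the \<open>r - 1\<close> left vertices other than \<open>u\<close>.\<close>
  have "\<exists>y\<in>N u. \<exists>z\<in>N u. y \<noteq> z \<and> (N y - {u}) \<inter> (N z - {u}) \<noteq> {}"
  proof (rule ccontr)
    assume neg: "\<not> ?thesis"
    have "d * (d - 1) \<le> (\<Sum>y\<in>N u. d - 1)" using N[OF u(1)] by simp
    also have "\<dots> \<le> (\<Sum>y\<in>N u. card (N y - {u}))"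
    proof (rule sum_mono)
      fix y assume y: "y \<in> N u"
      then have "d \<le> card (N y)" using NV by (intro N) auto
      then show "d - 1 \<le> card (N y - {u})"
        using card_Diff_singleton_if[of "N y" u] by (simp split: if_splits)
    qed
    also have "\<dots> = card (\<Union>y\<in>N u. N y - {u})"
      using neg fN by (intro card_UN_disjoint[symmetric]) auto
    also have "\<dots> \<le> card ({w \<in> ?V. isl w = True} - {u})"
    proof (rule card_mono)
      show "(\<Union>y\<in>N u. N y - {u}) \<subseteq> {w \<in> ?V. isl w = True} - {u}"
      proof
        fix w assume "w \<in> (\<Union>y\<in>N u. N y - {u})"
        then obtain y where y: "y \<in> N u" "w \<in> N y" "w \<noteq> u" by blast
        have "\<not> isl y" using y(1) NV[of u] u(2) by auto
        then show "w \<in> {w \<in> ?V. isl w = True} - {u}" using y NV[of y] by auto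
      qed
    qed (simp add: finite_K_rr)
    also have "\<dots> = r - 1" using u by (simp add: card_side_K_rr[of r True, simplified] card_Diff_singleton)
    finally show False using d(2) r by simp
  qed
  then obtain y z u1 where c: "?E u y" "?E u z" "y \<noteq> z" "?E y u1" "?E z u1" "u1 \<noteq> u"
    by (auto simp: N_def)
  have "distinct [u, y, u1, z]" using c irrefl by auto
  then have "full ?V" using full_all[of u y u1 z] common c sym by blast
  then show "num_components (FS X (K_rr r)) = 2" using two_components_if_full[OF r X] by simp
qed

section \<open>Graphs with more than two components\<close>

definition bip :: "nat \<Rightarrow> (nat \<Rightarrow> nat \<Rightarrow> bool) \<Rightarrow> (nat + nat) pair_pre_digraph" where
  "bip r P =
    \<lparr> pverts = pverts (K_rr r),
      parcs = {(x, y) \<in> parcs (K_rr r). \<exists>i j. P i j \<and> ((x, y) = (Inl i, Inr j) \<or> (x, y) = (Inr j, Inl i))} \<rparr>"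

lemma pverts_bip [simp]: "pverts (bip r P) = pverts (K_rr r)"
  by (simp add: bip_def)

lemma edge_subgraph_bip: "edge_subgraph (bip r P) (K_rr r)"
proof -
  interpret K: pair_graph "K_rr r" by (rule pair_graph_K_rr)
  have sub: "parcs (bip r P) \<subseteq> parcs (K_rr r)" by (auto simp: bip_def)
  have "pair_graph (bip r P)"
  proof
    show "finite (pverts (bip r P))" by (simp add: bip_def finite_K_rr)
    show "finite (parcs (bip r P))" using sub K.pair_finite_arcs finite_subset by blast
    show "symmetric (with_proj (bip r P))"
      by (auto simp: symmetric_def bip_def parcs_K_rr intro!: symI)
  qed (auto simp: bip_def parcs_K_rr)
  moreover interpret B: pair_graph "bip r P" by fact
  have "spanning (with_proj (bip r P)) (with_proj (K_rr r))"
    unfolding spanning_def subgraph_def compatible_def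
    using sub B.wf_digraph K.wf_digraph by simp
  ultimately show ?thesis by (simp add: edge_subgraph_def)
qed

lemma min_degree_bip:
  assumes "0 < r"
    and L: "\<And>i. i < r \<Longrightarrow> d \<le> card {j. j < r \<and> P i j}"
    and R: "\<And>j. j < r \<Longrightarrow> d \<le> card {i. i < r \<and> P i j}"
  shows "d \<le> min_degree (bip r P)"
proof -
  have "d \<le> out_degree (with_proj (bip r P)) v" if v: "v \<in> pverts (K_rr r)" for v
  proof (cases v)
    case (Inl i)
    have "{w. (v, w) \<in> parcs (bip r P)} = Inr ` {j. j < r \<and> P i j}"
      using v Inl by (auto simp: bip_def K_rr_def)
    then show ?thesis using L[of i] v Inl by (auto simp: out_degree_pair card_image pverts_K_rr)
  next
    case (Inr j)
    have "{w. (v, w) \<in> parcs (bip r P)} = Inl ` {i. i < r \<and> P i j}"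
      using v Inr by (auto simp: bip_def K_rr_def)
    then show ?thesis using R[of j] v Inr by (auto simp: out_degree_pair card_image pverts_K_rr)
  qed
  moreover have "pverts (K_rr r) \<noteq> {}" using assms(1) by (auto simp: pverts_K_rr)
  ultimately show ?thesis
    unfolding min_degree_def using finite_K_rr by (subst Min_ge_iff) (auto simp: bip_def)
qed

text \<open>The list \<open>ps\<close> exhibits three values of an invariant, hence at least three
  components.\<close>

lemma not_forces_two_components:
  assumes X: "edge_subgraph X (K_rr r)" and d: "d \<le> min_degree X"
    and f: "\<And>p a b. p permutes pverts (K_rr r) \<Longrightarrow> (a, b) \<in> parcs X \<Longrightarrow>
      (p a, p b) \<in> parcs (K_rr r) \<Longrightarrow> f (p \<circ> transpose a b) = f p"
    and p: "\<And>p. p \<in> set ps \<Longrightarrow> p permutes pverts (K_rr r)" "distinct (map f ps)" "length ps = 3"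
  shows "\<not> forces_two_components r d"
proof -
  note XD = edge_subgraph_K_rrD[OF X]
  have "3 = card (set (map f ps))" using p(2,3) distinct_card by force
  also have "\<dots> \<le> card (f ` {p. p permutes pverts (K_rr r)})"
    using p(1) finite_permutations[OF finite_K_rr] by (intro card_mono) auto
  also have "\<dots> \<le> num_components (FS X (K_rr r))"
    using num_components_FS_invariant(1)[OF XD(1) pair_graph_K_rr XD(2) refl, of f] f by blast
  finally show ?thesis using X d by (auto simp: forces_two_components_def)
qed

section \<open>Two disjoint complete bipartite graphs\<close>

lemma not_forces_half:
  assumes r: "2 \<le> r"
  shows "\<not> forces_two_components r (r div 2)"
proof -
  define h where "h = r div 2"
  have h: "0 < h" "h < r" "h \<le> r - h" using r by (auto simp: h_def)
  \<comment> \<open>Indices below \<open>h\<close> are joined to indices from \<open>h\<close> on,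
    which gives two disjoint complete bipartite graphs with sides of sizes \<open>h\<close> and
    \<open>r - h\<close>; \<open>C\<close> is the vertex set of one of them.\<close>
  let ?P = "\<lambda>i j. (i < h) \<noteq> (j < h)"
  define C where "C = Inl ` {..<h} \<union> Inr ` {h..<r}"
  have L: "h \<le> card {j. j < r \<and> (i < h) \<noteq> (j < h)}" for i
  proof -
    have "{j. j < r \<and> (i < h) \<noteq> (j < h)} = (if i < h then {h..<r} else {..<h})"
      using h by auto
    then show ?thesis using h by simp
  qed
  have "{i. i < r \<and> (i < h) \<noteq> (j < h)} = {i. i < r \<and> (j < h) \<noteq> (i < h)}" for j by auto
  then have deg: "h \<le> min_degree (bip r ?P)"
    using h L by (intro min_degree_bip) simp_all
  have inv: "(p \<circ> transpose a b) ` C = p ` C" if "(a, b) \<in> parcs (bip r ?P)"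
    for p :: "nat + nat \<Rightarrow> nat + nat" and a b
  proof -
    have "a \<in> C \<longleftrightarrow> b \<in> C" using that by (auto simp: C_def bip_def K_rr_def)
    then have "transpose a b ` C = C" by (rule transpose_image_eq)
    then show ?thesis by (metis image_comp)
  qed
  have C: "Inl 0 \<in> C" "Inr 0 \<notin> C" "Inl h \<notin> C" using h by (auto simp: C_def)
  \<comment> \<open>These exchanges bring \<open>Inr 0\<close> and \<open>Inl h\<close>,
    respectively, into \<open>C\<close>, so the three sets of persons in \<open>C\<close>
    differ.\<close>
  let ?p = "transpose (Inl 0) (Inr 0) :: nat + nat \<Rightarrow> nat + nat"
  let ?q = "transpose (Inl 0) (Inl h) :: nat + nat \<Rightarrow> nat + nat"
  have im: "Inr 0 \<in> ?p ` C" "Inr 0 \<notin> id ` C" "Inr 0 \<notin> ?q ` C" "Inl h \<in> ?q ` C" "Inl h \<notin> id ` C"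
    using C h by (auto simp: in_transpose_image_iff)
  have "(`) id C \<noteq> ?p ` C" "id ` C \<noteq> ?q ` C" "?p ` C \<noteq> ?q ` C"
    using im by blast+
  then have "distinct (map (\<lambda>p. p ` C) [id, ?p, ?q])" by simp
  moreover have "p permutes pverts (K_rr r)" if "p \<in> set [id, ?p, ?q]" for p
    using that h by (auto simp: permutes_id pverts_K_rr intro!: permutes_swap_id)
  ultimately show ?thesis
    unfolding h_def[symmetric]
    using not_forces_two_components[OF edge_subgraph_bip deg, of "\<lambda>p. p ` C" "[id, ?p, ?q]"] inv
    by simp
qed

section \<open>The hexagon\<close>

definition cyclic :: "nat \<Rightarrow> nat \<Rightarrow> nat \<Rightarrow> bool" where
  "cyclic x y z \<longleftrightarrow> x < y \<and> y < z \<or> y < z \<and> z < x \<or> z < x \<and> x < y"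

lemma cyclic_rotate: "cyclic x y z \<longleftrightarrow> cyclic y z x"
  by (auto simp: cyclic_def)

definition neighbours :: "nat \<Rightarrow> nat \<Rightarrow> bool" where
  "neighbours x y \<longleftrightarrow> y = Suc x \<or> x = Suc y \<or> x = 0 \<and> y = 5 \<or> x = 5 \<and> y = 0"

text \<open>A point that steps to a neighbouring place on the circle cannot overtake the other two,
  who occupy neither of the two places. Passing between 5 and 0 alters the linear order but not the
  cyclic one.\<close>

lemma cyclic_move:
  assumes "neighbours x x'" "x < 6" "x' < 6" "y < 6" "z < 6"
    and "y \<noteq> x" "y \<noteq> x'" "z \<noteq> x" "z \<noteq> x'"
  shows "cyclic x' y z \<longleftrightarrow> cyclic x y z"
proof -
  have "y < x \<or> x < y" "y < x' \<or> x' < y" "z < x \<or> x < z" "z < x' \<or> x' < z"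
    using assms by auto
  with assms(1-5) show ?thesis unfolding neighbours_def cyclic_def by (elim disjE conjE) auto
qed

text \<open>For \<open>r = 3\<close>, the graph with edges \<open>Inl i\<close> to \<open>Inr j\<close>, \<open>i \<noteq> j\<close>, is a hexagon with the vertices
  \<open>Inl 0, Inr 1, Inl 2, Inr 0, Inl 1, Inr 2\<close> in this cyclic order.\<close>

definition hexagon :: "nat + nat \<Rightarrow> nat" where
  "hexagon v = (case v of Inl i \<Rightarrow> (4 * i) mod 6 | Inr j \<Rightarrow> (4 * j + 3) mod 6)"

lemma pverts_K_33: "pverts (K_rr 3) = {Inl 0, Inl 1, Inl 2, Inr 0, Inr 1, Inr 2}"
  by (auto simp: pverts_K_rr lessThan_nat_numeral lessThan_Suc)

lemma inj_on_hexagon: "inj_on hexagon (pverts (K_rr 3))"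
  by (simp add: pverts_K_33 hexagon_def)

lemma hexagon_less: "hexagon v < 6"
  by (simp add: hexagon_def split: sum.split)

lemma neighbours_hexagon:
  assumes "(a, b) \<in> parcs (bip 3 (\<noteq>))"
  shows "neighbours (hexagon a) (hexagon b)"
proof -
  have "a \<in> pverts (K_rr 3)" "b \<in> pverts (K_rr 3)" using assms by (auto simp: bip_def parcs_K_rr)
  then show ?thesis
    using assms unfolding pverts_K_33 by (auto simp: bip_def K_rr_def hexagon_def neighbours_def)
qed

text \<open>\<open>inv p u\<close> is the position of the person \<open>u\<close>. A swap involves
  one person of each colour, so at most one of \<open>x\<close>, \<open>y\<close>, \<open>z\<close>
  moves, by one place round the hexagon, while the other two stand on neither end of the
  edge.\<close>

lemma hexagon_invariant:
  assumes p: "p permutes pverts (K_rr 3)" and ab: "(a, b) \<in> parcs (bip 3 (\<noteq>))"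
    and pab: "(p a, p b) \<in> parcs (K_rr 3)"
    and xyz: "{x, y, z} \<subseteq> pverts (K_rr 3)" "x \<noteq> y" "y \<noteq> z" "x \<noteq> z" "isl x = isl y" "isl y = isl z"
  defines "f \<equiv> \<lambda>p. cyclic (hexagon (inv p x)) (hexagon (inv p y)) (hexagon (inv p z))"
  shows "f (p \<circ> transpose a b) = f p"
proof -
  let ?V = "pverts (K_rr 3)"
  have nb: "neighbours (hexagon a) (hexagon b)" "neighbours (hexagon b) (hexagon a)"
    using neighbours_hexagon[OF ab] by (auto simp: neighbours_def)
  have abV: "a \<in> ?V" "b \<in> ?V" using ab by (auto simp: bip_def parcs_K_rr)
  have inv: "inv (p \<circ> transpose a b) u = transpose a b (inv p u)" for u
    using permutes_bij[OF p] by (simp add: o_inv_distrib)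
  have iV: "inv p u \<in> ?V" if "u \<in> ?V" for u
    using permutes_in_image[OF permutes_inv[OF p]] that by simp
  have ne: "inv p u \<noteq> inv p v" if "u \<noteq> v" for u v
    using permutes_inj[OF permutes_inv[OF p]] that by (auto dest: injD)
  have sep: "v \<noteq> p a" "v \<noteq> p b" if "u \<in> {p a, p b}" "isl u = isl v" "u \<noteq> v" for u v
    using that pab by (auto simp: parcs_K_rr)
  have fix': "transpose a b (inv p v) = inv p v" "hexagon (inv p v) \<noteq> hexagon a" "hexagon (inv p v) \<noteq> hexagon b"
    if v: "v \<noteq> p a" "v \<noteq> p b" "v \<in> ?V" for v
  proof -
    have n: "inv p v \<noteq> a" "inv p v \<noteq> b"
      using v permutes_inverses(1)[OF p] by auto
    then show "transpose a b (inv p v) = inv p v" by simp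
    show "hexagon (inv p v) \<noteq> hexagon a" "hexagon (inv p v) \<noteq> hexagon b"
      using n inj_on_hexagon abV iV[OF v(3)] by (auto dest: inj_onD)
  qed
  have move: "cyclic (hexagon (transpose a b (inv p u))) (hexagon (transpose a b (inv p v)))
        (hexagon (transpose a b (inv p w)))
      = cyclic (hexagon (inv p u)) (hexagon (inv p v)) (hexagon (inv p w))"
    if u: "u \<in> {p a, p b}" and "isl u = isl v" "isl u = isl w" "u \<noteq> v" "u \<noteq> w" "v \<in> ?V" "w \<in> ?V"
    for u v w
  proof -
    note s = sep[OF u that(2,4)] sep[OF u that(3,5)]
    note fv = fix'[OF s(1,2) that(6)] and fw = fix'[OF s(3,4) that(7)]
    have "inv p u = a \<or> inv p u = b" using u permutes_inverses(2)[OF p] by auto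
    then show ?thesis
    proof
      assume a: "inv p u = a"
      show ?thesis
        unfolding fv(1) fw(1) a transpose_apply_first
        using fv fw nb by (intro cyclic_move hexagon_less)
    next
      assume b: "inv p u = b"
      show ?thesis
        unfolding fv(1) fw(1) b transpose_apply_second
        using fv fw nb by (intro cyclic_move hexagon_less)
    qed
  qed
  consider "x \<in> {p a, p b}" | "y \<in> {p a, p b}" | "z \<in> {p a, p b}"
    | "x \<notin> {p a, p b}" "y \<notin> {p a, p b}" "z \<notin> {p a, p b}"
    by blast
  then show ?thesis
  proof cases
    case 1
    then show ?thesis using move[of x y z] xyz by (simp add: f_def inv)
  next
    case 2
    \<comment> \<open>\<open>move\<close> treats a moving first argument; rotating the triple
      reduces the other cases to it.\<close>
    then have "cyclic (hexagon (transpose a b (inv p y))) (hexagon (transpose a b (inv p z)))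
        (hexagon (transpose a b (inv p x)))
      = cyclic (hexagon (inv p y)) (hexagon (inv p z)) (hexagon (inv p x))"
      using xyz by (intro move) auto
    then show ?thesis unfolding f_def inv by (metis cyclic_rotate)
  next
    case 3
    then have "cyclic (hexagon (transpose a b (inv p z))) (hexagon (transpose a b (inv p x)))
        (hexagon (transpose a b (inv p y)))
      = cyclic (hexagon (inv p z)) (hexagon (inv p x)) (hexagon (inv p y))"
      using xyz by (intro move) auto
    then show ?thesis unfolding f_def inv by (metis cyclic_rotate)
  next
    case 4
    then show ?thesis using fix' xyz by (simp add: f_def inv)
  qed
qed

lemma not_forces_hexagon: "\<not> forces_two_components 3 2"
proof -
  let ?V = "pverts (K_rr 3)"
  let ?X = "bip 3 (\<noteq>)"
  have L: "2 \<le> card {j. j < 3 \<and> i \<noteq> j}" if "i < 3" for i :: nat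
  proof -
    have "{j. j < 3 \<and> i \<noteq> j} = {..<3} - {i}" by auto
    then show ?thesis using that by simp
  qed
  have "{i. i < 3 \<and> i \<noteq> j} = {i. i < 3 \<and> j \<noteq> i}" for j :: nat by auto
  then have deg: "2 \<le> min_degree ?X"
    using L by (intro min_degree_bip) simp_all
  define g :: "(nat \<Rightarrow> nat + nat) \<Rightarrow> (nat + nat \<Rightarrow> nat + nat) \<Rightarrow> bool" where
    "g c p \<longleftrightarrow> cyclic (hexagon (inv p (c 0))) (hexagon (inv p (c 1))) (hexagon (inv p (c 2)))" for c p
  \<comment> \<open>One orientation for each colour: exchanging two left or two right persons
    reverses just one of them, so three different pairs arise.\<close>
  let ?f = "\<lambda>p. (g Inl p, g Inr p)"
  have inv: "?f (p \<circ> transpose a b) = ?f p"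
    if "p permutes ?V" "(a, b) \<in> parcs ?X" "(p a, p b) \<in> parcs (K_rr 3)" for p a b
    using hexagon_invariant[OF that, of "Inl 0" "Inl 1" "Inl 2"]
      hexagon_invariant[OF that, of "Inr 0" "Inr 1" "Inr 2"]
    by (simp add: g_def pverts_K_33)
  let ?p = "transpose (Inl 0) (Inl 1) :: nat + nat \<Rightarrow> nat + nat"
  let ?q = "transpose (Inr 0) (Inr 1) :: nat + nat \<Rightarrow> nat + nat"
  have "distinct (map ?f [id, ?p, ?q])"
    by (simp add: g_def cyclic_def hexagon_def transpose_def)
  moreover have "p permutes ?V" if "p \<in> set [id, ?p, ?q]" for p
    using that by (auto simp: permutes_id pverts_K_33 intro!: permutes_swap_id)
  ultimately show ?thesis
    using not_forces_two_components[OF edge_subgraph_bip deg, of ?f "[id, ?p, ?q]"] inv by simp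
qed

section \<open>The exact threshold\<close>

lemma d_star_eqI:
  assumes "forces_two_components r (Suc d)" "\<not> forces_two_components r d"
  shows "d_star r = Suc d"
  unfolding d_star_def
proof (rule Least_equality)
  fix e assume e: "forces_two_components r e"
  show "Suc d \<le> e"
  proof (rule ccontr)
    assume "\<not> Suc d \<le> e"
    \<comment> \<open>A larger degree bound admits fewer graphs, so forcing passes from
      \<open>e\<close> to \<open>d \<ge> e\<close>.\<close>
    then have "forces_two_components r d"
      using e unfolding forces_two_components_def by (meson le_trans not_less_eq_eq)
    then show False using assms(2) by simp
  qed
qed (rule assms(1))

theorem corollary1p4:
  fixes r :: nat
  assumes "r \<ge> 2"
  shows "d_star r = (if r \<noteq> 3 then r div 2 + 1 else 3)"
proof (cases "r = 3")
  case True
  have "forces_two_components 3 3" by (rule forces_two_components_if) auto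
  then show ?thesis using d_star_eqI[of 3 2] not_forces_hexagon True by simp
next
  case False
  \<comment> \<open>This is \<open>r \<le> d * (d - 1)\<close> for \<open>d = r div 2 + 1\<close>.
    Among all \<open>r \<ge> 2\<close> it fails only for \<open>r = 3\<close>, where it would read
    \<open>3 \<le> 2\<close>.\<close>
  have "r \<le> (r div 2 + 1) * (r div 2)"
  proof (cases "r = 2")
    case False
    then have "2 \<le> r div 2" using assms \<open>r \<noteq> 3\<close> by linarith
    then have "(r div 2 + 1) * 2 \<le> (r div 2 + 1) * (r div 2)" by (rule mult_le_mono2)
    moreover have "r \<le> (r div 2 + 1) * 2" by simp
    ultimately show ?thesis by (rule order_trans[rotated])
  qed simp
  then have "forces_two_components r (r div 2 + 1)"
    using assms by (intro forces_two_components_if) auto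
  then show ?thesis using d_star_eqI[of r "r div 2"] not_forces_half assms False by simp
qed

end
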